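(* Let $X_1,\dots,X_L$ be independent GGC random variables with Thorin measures $\mu_1,\dots,\mu_L$, each of finite total mass, and let $X_{\mathrm{MRC}}=\sum_{i=1}^LX_i$ (the end-to-end channel power of an $L$-branch maximum ratio combining system). Then $X_{\mathrm{MRC}}$ is a GGC with Thorin measure $\sum_{i=1}^L\mu_i$, and its diversity order (Thorin mass) is $D=\sum_{i=1}^L\int_0^\infty\mu_i(du)<\infty$. If moreover $\mathbb{E}[X_{\mathrm{MRC}}]=1$ and $U\sim\mathrm{Gamma}(D,D)$, then $\mathbb{E}[g(U)]\le\mathbb{E}[g(X_{\mathrm{MRC}})]$ for all convex functions $g$ for which the expectations exist.
   Context: $\mathrm{Gamma}(D,\theta)$ denotes the Gamma distribution with shape $D$ and rate $\theta$, with density $\theta^Dx^{D-1}e^{-\theta x}/\Gamma(D)$ on $(0,\infty)$. A GGC (generalized gamma convolution) here is a nonnegative random variable $X$ with $\mathbb{E}[e^{-sX}]=\exp\left(-\int_0^\infty\log(1+s/u)\,\mu(du)\right)$ for $s\ge0$, where $\mu$ (the Thorin measure of $X$) is a nonzero nonnegative measure on $(0,\infty)$ with $\int_{(0,1]}|\log u|\,\mu(du)+\int_{(1,\infty)}u^{-1}\,\mu(du)<\infty$. The Thorin mass (diversity order) of $X$ is $\int_0^\infty\mu(du)$. *)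

theory Defs
  imports "HOL-Probability.Probability"
begin

text \<open>A nonzero measure on the Borel sets of the open half-line with Thorin's integrability
  condition.\<close>

definition thorin_measure :: "real measure \<Rightarrow> bool" where
  "thorin_measure \<mu> \<longleftrightarrow>
     sets \<mu> = sets (restrict_space borel {0<..}) \<and>
     emeasure \<mu> (space \<mu>) \<noteq> 0 \<and>
     (\<integral>\<^sup>+u\<in>{0<..1}. ennreal \<bar>ln u\<bar> \<partial>\<mu>) + (\<integral>\<^sup>+u\<in>{1<..}. ennreal (1 / u) \<partial>\<mu>) < \<infinity>"

definition thorin_mass :: "real measure \<Rightarrow> ennreal" where
  "thorin_mass \<mu> = (\<integral>\<^sup>+u. 1 \<partial>\<mu>)"

text \<open>\<open>ggc M X \<mu>\<close>: the random variable \<open>X\<close> on \<open>M\<close> is a GGC with Thorin measure \<open>\<mu>\<close>.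
  A Laplace transform never vanishes, so the Laplace exponent of a GGC is finite. This has to be
  required explicitly, because the Bochner integral of a non-integrable function is 0. For
  \<open>s = 0\<close> the equation says that \<open>M\<close> has total mass 1.\<close>

definition ggc :: "'a measure \<Rightarrow> ('a \<Rightarrow> real) \<Rightarrow> real measure \<Rightarrow> bool" where
  "ggc M X \<mu> \<longleftrightarrow>
     X \<in> borel_measurable M \<and>
     (AE \<omega> in M. 0 \<le> X \<omega>) \<and>
     thorin_measure \<mu> \<and>
     (\<forall>s\<ge>0. integrable \<mu> (\<lambda>u. ln (1 + s / u)) \<and>
            (\<integral>\<omega>. exp (- s * X \<omega>) \<partial>M) = exp (- (\<integral>u. ln (1 + s / u) \<partial>\<mu>)))"

text \<open>The setwise sum of finitely many measures on the open half-line; see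
  \<open>emeasure_measure_sum\<close>.\<close>

definition measure_sum :: "'i set \<Rightarrow> ('i \<Rightarrow> real measure) \<Rightarrow> real measure" where
  "measure_sum I \<mu> =
     measure_of {0<..} (sets (restrict_space borel {0<..})) (\<lambda>A. \<Sum>i\<in>I. emeasure (\<mu> i) A)"

lemma sets_measure_sum: "sets (measure_sum I \<mu>) = sets (restrict_space borel {0<..})"
proof -
  have "space (restrict_space borel {0::real<..}) = {0<..}"
    by (simp add: space_restrict_space)
  then show ?thesis
    unfolding measure_sum_def by (metis sets.sets_measure_of_eq)
qed

lemma emeasure_measure_sum:
  assumes "finite I" "\<And>i. i \<in> I \<Longrightarrow> sets (\<mu> i) = sets (restrict_space borel {0<..})"
    and A: "A \<in> sets (restrict_space borel {0<..})"
  shows "emeasure (measure_sum I \<mu>) A = (\<Sum>i\<in>I. emeasure (\<mu> i) A)"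
proof (rule emeasure_measure_of[OF measure_sum_def])
  show "sets (restrict_space borel {0<..}) \<subseteq> Pow {0::real<..}"
    using sets.space_closed[of "restrict_space borel {0::real<..}"]
    by (simp add: space_restrict_space)
  show "positive (sets (measure_sum I \<mu>)) (\<lambda>A. \<Sum>i\<in>I. emeasure (\<mu> i) A)"
    by (simp add: positive_def)
  show "countably_additive (sets (measure_sum I \<mu>)) (\<lambda>A. \<Sum>i\<in>I. emeasure (\<mu> i) A)"
    unfolding countably_additive_def
  proof (intro allI impI)
    fix F :: "nat \<Rightarrow> real set"
    assume F: "range F \<subseteq> sets (measure_sum I \<mu>)" "disjoint_family F"
    have "(\<Sum>n. \<Sum>i\<in>I. emeasure (\<mu> i) (F n)) = (\<Sum>i\<in>I. \<Sum>n. emeasure (\<mu> i) (F n))"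
      by (intro suminf_sum) simp
    also have "\<dots> = (\<Sum>i\<in>I. emeasure (\<mu> i) (\<Union> (range F)))"
      using F assms(2) by (intro sum.cong suminf_emeasure) (auto simp: sets_measure_sum)
    finally show "(\<Sum>n. \<Sum>i\<in>I. emeasure (\<mu> i) (F n)) = (\<Sum>i\<in>I. emeasure (\<mu> i) (\<Union> (range F)))" .
  qed
  show "A \<in> sets (measure_sum I \<mu>)"
    using A by (simp add: sets_measure_sum)
qed

definition mrc_power :: "nat \<Rightarrow> (nat \<Rightarrow> 'a \<Rightarrow> real) \<Rightarrow> 'a \<Rightarrow> real" where
  "mrc_power L X \<omega> = (\<Sum>i=1..L. X i \<omega>)"

definition gamma_density :: "real \<Rightarrow> real \<Rightarrow> real \<Rightarrow> real" where
  "gamma_density D \<theta> x =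
     (if 0 < x then \<theta> powr D * x powr (D - 1) * exp (- \<theta> * x) / Gamma D else 0)"

end

(* Gamma(D,D) lies below X in the convex order because both arise from gamma convolutions by
   merging. If A ~ Gamma(a,1) and B ~ Gamma(b,1) are independent, then A + B ~ Gamma(a+b,1) is
   independent of A/(A+B) ~ Beta(a,b), so by Jensen's inequality conditional on A + B replacing
   cA + dB by (ac+bd)/(a+b) times A + B decreases expectations of convex functions. Iterating, a
   finite gamma convolution dominates the single gamma variable with the same total shape and mean.

   A GGC is reached from finite gamma convolutions by approximating u -> 1/u from below by simple
   functions. Their Laplace transforms converge, which are moments of exp(-X) in [0,1], so
   Weierstrass' theorem gives convergence for test functions psi(x) = f(exp(-x)) with f continuous
   on [0,1]. Nonnegative decreasing convex psi vanishing near infinity are of this form, and for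
   decreasing psi it does no harm that the approximants have mean at most 1. A general convex g on
   (0,oo) is, up to an affine function, the pointwise limit of such psi: keep g on [1/n,n] and
   continue it by supporting lines. *)

theory Submission
  imports Defs
begin

subsection \<open>Gamma and beta distributions\<close>

lemma borel_measurable_gamma_density [measurable]: "gamma_density a \<theta> \<in> borel_measurable borel"
  unfolding gamma_density_def by measurable

lemma gamma_density_nonneg: "0 < a \<Longrightarrow> 0 \<le> gamma_density a \<theta> x"
  by (auto simp: gamma_density_def Gamma_real_pos intro!: divide_nonneg_pos mult_nonneg_nonneg)

text \<open>The substitution x -> \<theta> x, which reduces every rate to rate 1.\<close>

lemma nn_integral_gamma_density_scale:
  assumes "0 < \<theta>" and [measurable]: "f \<in> borel_measurable borel"
  shows "(\<integral>\<^sup>+x. ennreal (gamma_density a \<theta> x) * f x \<partial>lborel)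
    = (\<integral>\<^sup>+x. ennreal (gamma_density a 1 x) * f (x / \<theta>) \<partial>lborel)"
proof -
  have "(\<integral>\<^sup>+x. ennreal (gamma_density a 1 x) * f (x / \<theta>) \<partial>lborel)
    = \<theta> * (\<integral>\<^sup>+x. ennreal (gamma_density a 1 (0 + \<theta> * x)) * f ((0 + \<theta> * x) / \<theta>) \<partial>lborel)"
    using assms by (subst nn_integral_real_affine[of _ \<theta> 0]) auto
  also have "\<dots> = (\<integral>\<^sup>+x. \<theta> * (ennreal (gamma_density a 1 (0 + \<theta> * x)) * f ((0 + \<theta> * x) / \<theta>)) \<partial>lborel)"
    by (simp add: nn_integral_cmult)
  also have "\<dots> = (\<integral>\<^sup>+x. ennreal (gamma_density a \<theta> x) * f x \<partial>lborel)"
  proof (intro nn_integral_cong)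
    fix x
    have "\<theta> * gamma_density a 1 (\<theta> * x) = gamma_density a \<theta> x"
      using assms(1)
      by (auto simp: gamma_density_def zero_less_mult_iff powr_mult powr_diff)
    then have "ennreal \<theta> * ennreal (gamma_density a 1 (\<theta> * x)) = ennreal (gamma_density a \<theta> x)"
      using assms(1) by (metis ennreal_mult' less_imp_le)
    then show "ennreal \<theta> * (ennreal (gamma_density a 1 (0 + \<theta> * x)) * f ((0 + \<theta> * x) / \<theta>))
        = ennreal (gamma_density a \<theta> x) * f x"
      using assms(1) by (simp add: mult.assoc[symmetric])
  qed
  finally show ?thesis ..
qed

lemma nn_integral_gamma_density:
  assumes "0 < a" "0 < \<theta>"
  shows "(\<integral>\<^sup>+x. ennreal (gamma_density a \<theta> x) \<partial>lborel) = 1"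
proof -
  have "ennreal (Gamma a) * (\<integral>\<^sup>+x. ennreal (gamma_density a 1 x) \<partial>lborel)
    = (\<integral>\<^sup>+x. ennreal (Gamma a) * ennreal (gamma_density a 1 x) \<partial>lborel)"
    by (simp add: nn_integral_cmult)
  also have "\<dots> = (\<integral>\<^sup>+x. ennreal (indicator {0..} x * x powr (a - 1) / exp x) \<partial>lborel)"
    using Gamma_real_pos[OF assms(1)]
    by (intro nn_integral_cong)
      (auto simp: gamma_density_def ennreal_mult'[symmetric] exp_minus field_simps indicator_def)
  also have "\<dots> = ennreal (Gamma a) * 1"
    using Gamma_conv_nn_integral_real[OF assms(1)] by simp
  finally have "(\<integral>\<^sup>+x. ennreal (gamma_density a 1 x) \<partial>lborel) = 1"
    using Gamma_real_pos[OF assms(1)] by (subst (asm) ennreal_mult_cancel_left) auto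
  then show ?thesis
    using nn_integral_gamma_density_scale[OF assms(2), of "\<lambda>_. 1" a] by simp
qed

text \<open>The rate is fixed at 1 because merging adds shapes only at a common rate; scales are
  carried separately as factors.\<close>

definition gamma_measure :: "real \<Rightarrow> real measure" where
  "gamma_measure a = density lborel (\<lambda>x. ennreal (gamma_density a 1 x))"

lemma sets_gamma_measure [simp, measurable_cong]: "sets (gamma_measure a) = sets borel"
  by (simp add: gamma_measure_def)

lemma space_gamma_measure [simp]: "space (gamma_measure a) = UNIV"
  by (simp add: gamma_measure_def)

lemma prob_space_gamma_measure: "0 < a \<Longrightarrow> prob_space (gamma_measure a)"
  by (intro prob_spaceI) (simp add: gamma_measure_def emeasure_density nn_integral_gamma_density)

lemma nn_integral_gamma_measure:
  "f \<in> borel_measurable borel \<Longrightarrow>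
    (\<integral>\<^sup>+x. f x \<partial>gamma_measure a) = (\<integral>\<^sup>+x. ennreal (gamma_density a 1 x) * f x \<partial>lborel)"
  unfolding gamma_measure_def by (intro nn_integral_density) auto

lemma AE_gamma_measure_pos: "AE x in gamma_measure a. 0 < x"
  unfolding gamma_measure_def by (subst AE_density) (auto simp: gamma_density_def)

text \<open>Exponential tilting: exp (- t x) times the density of rate 1 is (1 + t) to the power -a
  times the density of rate 1 + t. The value is written through ln (1 + t) to match the integrand of
  a Thorin exponent.\<close>

lemma nn_integral_gamma_measure_exp:
  assumes "0 < a" "0 \<le> t"
  shows "(\<integral>\<^sup>+x. ennreal (exp (- (t * x))) \<partial>gamma_measure a) = ennreal (exp (- (a * ln (1 + t))))"
proof -
  have "(\<integral>\<^sup>+x. ennreal (exp (- (t * x))) \<partial>gamma_measure a)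
    = (\<integral>\<^sup>+x. ennreal (exp (- (a * ln (1 + t)))) * ennreal (gamma_density a (1 + t) x) \<partial>lborel)"
    unfolding nn_integral_gamma_measure[of "\<lambda>x. ennreal (exp (- (t * x)))", simplified]
  proof (intro nn_integral_cong)
    fix x
    have "exp (- (a * ln (1 + t))) * gamma_density a (1 + t) x = gamma_density a 1 x * exp (- (t * x))"
      using assms(2)
      by (simp add: gamma_density_def powr_def mult_exp_exp algebra_simps)
    then show "ennreal (gamma_density a 1 x) * ennreal (exp (- (t * x)))
      = ennreal (exp (- (a * ln (1 + t)))) * ennreal (gamma_density a (1 + t) x)"
      using gamma_density_nonneg[OF assms(1)] by (simp add: ennreal_mult'[symmetric] ennreal_mult''[symmetric])
  qed
  also have "\<dots> = ennreal (exp (- (a * ln (1 + t))))"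
    using assms by (simp add: nn_integral_cmult nn_integral_gamma_density)
  finally show ?thesis .
qed

text \<open>Multiplying the density of shape a by x gives a / \<theta> times the density of shape a
  + 1, which has total mass 1.\<close>

lemma gamma_distributed_mean:
  assumes "0 < a" "0 < \<theta>"
    and U: "distributed N lborel U (\<lambda>x. ennreal (gamma_density a \<theta> x))"
  shows "integrable N U" and "(\<integral>\<omega>. U \<omega> \<partial>N) = a / \<theta>"
proof -
  have [measurable]: "U \<in> borel_measurable N"
    using distributed_measurable[OF U] by simp
  have shift: "gamma_density a \<theta> x * x = a / \<theta> * gamma_density (a + 1) \<theta> x" for x
  proof -
    have "Gamma (a + 1) = a * Gamma a"
      using assms(1) nonpos_Ints_nonpos[of a] by (intro Gamma_plus1) auto
    then show ?thesis
      using assms(1,2) by (simp add: gamma_density_def powr_add powr_diff)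
  qed
  have i: "integrable lborel (gamma_density (a + 1) \<theta>)"
    using assms nn_integral_gamma_density[of "a + 1" \<theta>] gamma_density_nonneg[of "a + 1" \<theta>]
    by (intro integrableI_nonneg) auto
  have v: "(\<integral>x. gamma_density (a + 1) \<theta> x \<partial>lborel) = 1"
    using assms nn_integral_gamma_density[of "a + 1" \<theta>] gamma_density_nonneg[of "a + 1" \<theta>]
    by (subst integral_eq_nn_integral) auto
  show "integrable N U"
    using distributed_integrable[OF U, of "\<lambda>x. x"] gamma_density_nonneg[OF assms(1)] i
    by (simp add: shift)
  show "(\<integral>\<omega>. U \<omega> \<partial>N) = a / \<theta>"
    using distributed_integral[OF U, of "\<lambda>x. x"] gamma_density_nonneg[OF assms(1)] v
    by (simp add: shift)
qed

definition beta_measure :: "real \<Rightarrow> real \<Rightarrow> real measure" where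
  "beta_measure a b = density lborel (\<lambda>t. ennreal
     (indicator {0<..<1} t * t powr (a - 1) * (1 - t) powr (b - 1) / Beta a b))"

lemma sets_beta_measure [simp, measurable_cong]: "sets (beta_measure a b) = sets borel"
  by (simp add: beta_measure_def)

lemma space_beta_measure [simp]: "space (beta_measure a b) = UNIV"
  by (simp add: beta_measure_def)

lemma Beta_real_pos: "0 < a \<Longrightarrow> 0 < b \<Longrightarrow> 0 < Beta a (b::real)"
  by (simp add: Beta_def Gamma_real_pos)

lemma nn_integral_Beta:
  assumes "0 < a" "0 < (b::real)"
  shows "(\<integral>\<^sup>+t. ennreal (indicator {0<..<1} t * t powr (a - 1) * (1 - t) powr (b - 1)) \<partial>lborel)
    = ennreal (Beta a b)"
proof -
  have "((\<lambda>t. t powr (a - 1) * (1 - t) powr (b - 1)) has_integral Beta a b) {0<..<1}"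
    using has_integral_Beta_real[OF assms] by (simp add: has_integral_Icc_iff_Ioo)
  from nn_integral_has_integral_lebesgue[OF _ this] show ?thesis
    by (simp add: mult.assoc)
qed

lemma prob_space_beta_measure:
  assumes "0 < a" "0 < b"
  shows "prob_space (beta_measure a b)"
proof (intro prob_spaceI)
  have "(\<integral>\<^sup>+t. ennreal (indicator {0<..<1} t * t powr (a - 1) * (1 - t) powr (b - 1) / Beta a b) \<partial>lborel)
    = (\<integral>\<^sup>+t. ennreal (indicator {0<..<1} t * t powr (a - 1) * (1 - t) powr (b - 1)) / ennreal (Beta a b) \<partial>lborel)"
    using Beta_real_pos[OF assms] by (intro nn_integral_cong divide_ennreal[symmetric]) auto
  also have "\<dots> = 1"
    using Beta_real_pos[OF assms]
    by (simp add: nn_integral_divide nn_integral_Beta[OF assms] ennreal_divide_self)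
  finally show "emeasure (beta_measure a b) (space (beta_measure a b)) = 1"
    by (simp add: beta_measure_def emeasure_density)
qed

text \<open>The factor t raises the first parameter by one, and Beta (a + 1) b / Beta a b = a / (a +
  b) by the recursion of the beta function.\<close>

lemma beta_measure_mean:
  assumes "0 < a" "0 < b"
  shows "integrable (beta_measure a b) (\<lambda>t. t)" and "(\<integral>t. t \<partial>beta_measure a b) = a / (a + b)"
proof -
  have pos: "0 < Beta a b"
    using Beta_real_pos[OF assms] .
  have "ennreal (indicator {0<..<1} t * t powr (a - 1) * (1 - t) powr (b - 1) / Beta a b) * ennreal t
    = ennreal (indicator {0<..<1} t * t powr (a + 1 - 1) * (1 - t) powr (b - 1)) / ennreal (Beta a b)" for t
    using pos by (auto simp: indicator_def divide_ennreal ennreal_mult'[symmetric] powr_diff)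
  then have "(\<integral>\<^sup>+t. ennreal t \<partial>beta_measure a b)
    = (\<integral>\<^sup>+t. ennreal (indicator {0<..<1} t * t powr (a + 1 - 1) * (1 - t) powr (b - 1)) / ennreal (Beta a b) \<partial>lborel)"
    unfolding beta_measure_def by (subst nn_integral_density) auto
  also have "\<dots> = ennreal (Beta (a + 1) b / Beta a b)"
    using pos assms Beta_real_pos[of "a + 1" b]
    by (subst nn_integral_divide, measurable, subst nn_integral_Beta) (auto simp: divide_ennreal)
  also have "Beta (a + 1) b / Beta a b = a / (a + b)"
    using Beta_plus1_left[of a b] nonpos_Ints_nonpos[of a] assms pos
    by (auto simp: field_simps)
  finally have *: "(\<integral>\<^sup>+t. ennreal t \<partial>beta_measure a b) = ennreal (a / (a + b))" .
  have nn: "AE t in beta_measure a b. 0 \<le> t"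
    unfolding beta_measure_def by (subst AE_density) (auto simp: indicator_def)
  show "integrable (beta_measure a b) (\<lambda>t. t)"
    using nn * by (intro integrableI_nonneg) auto
  show "(\<integral>t. t \<partial>beta_measure a b) = a / (a + b)"
    using nn * assms by (subst integral_eq_nn_integral) auto
qed

subsection \<open>Merging two gamma variables\<close>

text \<open>The change of variables x = u t, y = u (1 - t). That the right-hand side is an iterated
  integral with a fixed inner law expresses that the total u and the share t are independent. The
  planar substitution is split into two one-dimensional ones with Fubini in between.\<close>

lemma nn_integral_gamma_pair:
  assumes a: "0 < a" and b: "0 < b"
    and f [measurable]: "case_prod f \<in> borel_measurable (borel \<Otimes>\<^sub>M borel)"
  shows "(\<integral>\<^sup>+x. \<integral>\<^sup>+y. f x y \<partial>gamma_measure b \<partial>gamma_measure a)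
    = (\<integral>\<^sup>+u. \<integral>\<^sup>+t. f (u * t) (u * (1 - t)) \<partial>beta_measure a b \<partial>gamma_measure (a + b))"
proof -
  let ?g = "\<lambda>a x. ennreal (gamma_density a 1 x)"
  let ?\<beta> = "\<lambda>t. ennreal (indicator {0<..<1} t * t powr (a - 1) * (1 - t) powr (b - 1) / Beta a b)"
  \<comment> \<open>Lets automatic measurability proofs see through the curried f with arbitrary
    arguments.\<close>
  have [measurable]: "(\<lambda>x. f (p x) (q x)) \<in> borel_measurable M"
    if "p \<in> borel_measurable M" "q \<in> borel_measurable M" for p q and M :: "'c measure"
    using measurable_compose[OF measurable_Pair[OF that] f] by simp
  have "(\<integral>\<^sup>+x. \<integral>\<^sup>+y. f x y \<partial>gamma_measure b \<partial>gamma_measure a)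
    = (\<integral>\<^sup>+x. ?g a x * (\<integral>\<^sup>+y. ?g b y * f x y \<partial>lborel) \<partial>lborel)"
    by (simp add: nn_integral_gamma_measure)
  \<comment> \<open>First substitution: y = u - x with x fixed.\<close>
  also have "\<dots> = (\<integral>\<^sup>+x. ?g a x * (\<integral>\<^sup>+u. ?g b (u - x) * f x (u - x) \<partial>lborel) \<partial>lborel)"
    by (intro nn_integral_cong, subst nn_integral_real_affine[where c=1 and t="- x" for x])
       (auto simp: add.commute)
  also have "\<dots> = (\<integral>\<^sup>+x. \<integral>\<^sup>+u. ?g a x * (?g b (u - x) * f x (u - x)) \<partial>lborel \<partial>lborel)"
    by (simp add: nn_integral_cmult)
  also have "\<dots> = (\<integral>\<^sup>+u. \<integral>\<^sup>+x. ?g a x * (?g b (u - x) * f x (u - x)) \<partial>lborel \<partial>lborel)"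
    by (intro lborel_pair.Fubini') (simp add: case_prod_unfold)
  also have "\<dots> = (\<integral>\<^sup>+u. ?g (a + b) u * (\<integral>\<^sup>+t. ?\<beta> t * f (u * t) (u * (1 - t)) \<partial>lborel) \<partial>lborel)"
  proof (intro nn_integral_cong)
    fix u :: real
    show "(\<integral>\<^sup>+x. ?g a x * (?g b (u - x) * f x (u - x)) \<partial>lborel)
      = ?g (a + b) u * (\<integral>\<^sup>+t. ?\<beta> t * f (u * t) (u * (1 - t)) \<partial>lborel)"
    proof (cases "0 < u")
      \<comment> \<open>Second substitution: x = u t with u fixed, which contributes the Jacobian
        u.\<close>
      case True
      have "(\<integral>\<^sup>+x. ?g a x * (?g b (u - x) * f x (u - x)) \<partial>lborel)
        = (\<integral>\<^sup>+t. ennreal u * (?g a (u * t) * (?g b (u - u * t) * f (u * t) (u - u * t))) \<partial>lborel)"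
        using True by (subst nn_integral_real_affine[where c=u and t=0]) (auto simp: nn_integral_cmult)
      also have "\<dots> = (\<integral>\<^sup>+t. ?g (a + b) u * (?\<beta> t * f (u * t) (u * (1 - t))) \<partial>lborel)"
      proof (intro nn_integral_cong)
        fix t :: real
        \<comment> \<open>The Jacobian supplies the missing power: (a - 1) + (b - 1) + 1 = a + b -
          1. The gamma constants combine to 1 / (Gamma (a + b) * Beta a b).\<close>
        have *: "u * (gamma_density a 1 (u * t) * gamma_density b 1 (u * (1 - t)))
          = gamma_density (a + b) 1 u
            * (indicator {0<..<1} t * t powr (a - 1) * (1 - t) powr (b - 1) / Beta a b)"
        proof (cases "t \<in> {0<..<1}")
          case t: True
          then have "gamma_density a 1 (u * t) * gamma_density b 1 (u * (1 - t))
            = (u powr (a - 1) * u powr (b - 1)) * (t powr (a - 1) * (1 - t) powr (b - 1))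
              * (exp (- (u * t)) * exp (- (u * (1 - t)))) / (Gamma a * Gamma b)"
            using True by (simp add: gamma_density_def powr_mult)
          also have "exp (- (u * t)) * exp (- (u * (1 - t))) = exp (- u)"
            by (simp add: mult_exp_exp algebra_simps)
          also have "u powr (a - 1) * u powr (b - 1) = u powr (a + b - 1) / u"
            using True by (simp add: powr_diff powr_add)
          finally show ?thesis
            using True t Gamma_real_pos[of "a + b"] a b
            by (simp add: gamma_density_def Beta_def less_imp_neq[symmetric])
        qed (use True in \<open>auto simp: gamma_density_def indicator_def zero_less_mult_iff\<close>)
        have "ennreal u * (?g a (u * t) * ?g b (u * (1 - t))) = ?g (a + b) u * ?\<beta> t"
        proof -
          have "ennreal u * (?g a (u * t) * ?g b (u * (1 - t)))
            = ennreal (u * (gamma_density a 1 (u * t) * gamma_density b 1 (u * (1 - t))))"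
            using True a b by (simp add: ennreal_mult' gamma_density_nonneg)
          also have "\<dots> = ?g (a + b) u * ?\<beta> t"
            unfolding * using a b by (intro ennreal_mult' gamma_density_nonneg) simp
          finally show ?thesis .
        qed
        then have "ennreal u * (?g a (u * t) * ?g b (u * (1 - t))) * f (u * t) (u * (1 - t))
          = ?g (a + b) u * ?\<beta> t * f (u * t) (u * (1 - t))"
          by simp
        then show "ennreal u * (?g a (u * t) * (?g b (u - u * t) * f (u * t) (u - u * t)))
          = ?g (a + b) u * (?\<beta> t * f (u * t) (u * (1 - t)))"
          by (simp only: right_diff_distrib mult_1_right mult.assoc)
      qed
      also have "\<dots> = ?g (a + b) u * (\<integral>\<^sup>+t. ?\<beta> t * f (u * t) (u * (1 - t)) \<partial>lborel)"
        by (simp add: nn_integral_cmult)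
      finally show ?thesis .
    next
      \<comment> \<open>For u \<le> 0 the numbers x and u - x cannot both be positive, so both sides
        vanish.\<close>
      case False
      then have "?g a x * (?g b (u - x) * f x (u - x)) = 0" for x
        by (auto simp: gamma_density_def)
      then have "(\<integral>\<^sup>+x. ?g a x * (?g b (u - x) * f x (u - x)) \<partial>lborel) = 0"
        by (simp only: nn_integral_const mult_zero_left)
      then show ?thesis
        using False by (simp add: gamma_density_def)
    qed
  qed
  also have "\<dots> = (\<integral>\<^sup>+u. \<integral>\<^sup>+t. f (u * t) (u * (1 - t)) \<partial>beta_measure a b \<partial>gamma_measure (a + b))"
    by (simp add: nn_integral_gamma_measure beta_measure_def nn_integral_density)
  finally show ?thesis .
qed

lemma convex_on_UNIV_measurable:
  assumes "convex_on UNIV (\<psi> :: real \<Rightarrow> real)"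
  shows "\<psi> \<in> borel_measurable borel"
  using convex_on_continuous[OF open_UNIV assms] borel_measurable_continuous_onI by blast

text \<open>Given the total u, the average of c (u t) + d (u (1 - t)) over the beta-distributed
  share t is u (a c + b d) / (a + b). Jensen's inequality in t, integrated over u, gives the
  bound.\<close>

lemma nn_integral_gamma_merge:
  fixes \<psi> :: "real \<Rightarrow> real"
  assumes a: "0 < a" and b: "0 < b" and cvx: "convex_on UNIV \<psi>" and nonneg: "\<And>x. 0 \<le> \<psi> x"
  shows "(\<integral>\<^sup>+u. ennreal (\<psi> (u * ((a * c + b * d) / (a + b)))) \<partial>gamma_measure (a + b))
    \<le> (\<integral>\<^sup>+x. \<integral>\<^sup>+y. ennreal (\<psi> (c * x + d * y)) \<partial>gamma_measure b \<partial>gamma_measure a)"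
proof -
  interpret \<beta>: prob_space "beta_measure a b"
    using prob_space_beta_measure[OF a b] .
  have [measurable]: "\<psi> \<in> borel_measurable borel"
    using cvx by (rule convex_on_UNIV_measurable)
  have "ennreal (\<psi> (u * ((a * c + b * d) / (a + b))))
    \<le> (\<integral>\<^sup>+t. ennreal (\<psi> (c * (u * t) + d * (u * (1 - t)))) \<partial>beta_measure a b)" for u
  proof (cases "integrable (beta_measure a b) (\<lambda>t. \<psi> (c * (u * t) + d * (u * (1 - t))))")
    case True
    have i: "integrable (beta_measure a b) (\<lambda>t. c * (u * t) + d * (u * (1 - t)))"
      using beta_measure_mean(1)[OF a b] by auto
    have "(\<integral>t. c * (u * t) + d * (u * (1 - t)) \<partial>beta_measure a b)
      = c * (u * (a / (a + b))) + d * (u * (1 - a / (a + b)))"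
      using beta_measure_mean[OF a b] by (simp add: \<beta>.prob_space[simplified])
    also have "1 - a / (a + b) = b / (a + b)"
      using a b by (simp add: field_simps)
    also have "c * (u * (a / (a + b))) + d * (u * (b / (a + b))) = u * ((a * c + b * d) / (a + b))"
      by (simp add: add_divide_distrib algebra_simps)
    finally have "\<psi> (u * ((a * c + b * d) / (a + b)))
      \<le> (\<integral>t. \<psi> (c * (u * t) + d * (u * (1 - t))) \<partial>beta_measure a b)"
      using \<beta>.jensens_inequality[OF i, where I = UNIV and q = \<psi>] cvx True by fastforce
    then show ?thesis
      using True nonneg by (subst nn_integral_eq_integral) (auto intro!: ennreal_leI)
  next
    \<comment> \<open>A nonnegative measurable function that is not integrable has infinite
      integral, so the bound is trivial here.\<close>
    case False
    have "\<not> (\<integral>\<^sup>+t. ennreal (\<psi> (c * (u * t) + d * (u * (1 - t)))) \<partial>beta_measure a b) < \<infinity>"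
    proof
      assume fin: "(\<integral>\<^sup>+t. ennreal (\<psi> (c * (u * t) + d * (u * (1 - t)))) \<partial>beta_measure a b) < \<infinity>"
      have "integrable (beta_measure a b) (\<lambda>t. \<psi> (c * (u * t) + d * (u * (1 - t))))"
        by (rule integrableI_nonneg[OF _ _ fin]) (measurable, simp add: nonneg)
      with False show False ..
    qed
    then show ?thesis
      by (simp add: not_less top.extremum_unique)
  qed
  then show ?thesis
    using nn_integral_gamma_pair[OF a b, of "\<lambda>x y. ennreal (\<psi> (c * x + d * y))"]
    by (simp add: nn_integral_mono)
qed

subsection \<open>Finite gamma convolutions\<close>

text \<open>An entry (a, c) stands for an independent summand c A with A ~ Gamma(a, 1). Scales c are
  stored instead of rates 1 / c so that c = 0 is possible, which simple functions below 1 / u may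
  require.\<close>

primrec gamma_convolution :: "(real \<times> real) list \<Rightarrow> real measure" where
  "gamma_convolution [] = return borel 0"
| "gamma_convolution (p # l) =
     convolution (distr (gamma_measure (fst p)) borel ((*) (snd p))) (gamma_convolution l)"

lemma sets_gamma_convolution [simp, measurable_cong]: "sets (gamma_convolution l) = sets borel"
  by (cases l) auto

lemma space_gamma_convolution [simp]: "space (gamma_convolution l) = UNIV"
  by (cases l) (auto simp: convolution_def)

lemma prob_space_gamma_convolution:
  "(\<And>a c. (a, c) \<in> set l \<Longrightarrow> 0 < a) \<Longrightarrow> prob_space (gamma_convolution l)"
proof (induction l)
  case Nil
  then show ?case by (auto intro: prob_space_return)
next
  case (Cons p l)
  interpret L: prob_space "gamma_convolution l"
    using Cons by auto
  interpret G: prob_space "distr (gamma_measure (fst p)) borel ((*) (snd p))"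
    using Cons.prems[of "fst p" "snd p"]
    by (intro prob_space.prob_space_distr prob_space_gamma_measure) auto
  interpret pair_prob_space "distr (gamma_measure (fst p)) borel ((*) (snd p))" "gamma_convolution l" ..
  show ?case
    by (simp add: convolution_def) (intro prob_space_distr, measurable)
qed

lemma nn_integral_gamma_convolution_Cons:
  assumes "\<And>a c. (a, c) \<in> set (p # l) \<Longrightarrow> 0 < a" and [measurable]: "f \<in> borel_measurable borel"
  shows "(\<integral>\<^sup>+x. f x \<partial>gamma_convolution (p # l))
    = (\<integral>\<^sup>+x. \<integral>\<^sup>+y. f (snd p * x + y) \<partial>gamma_convolution l \<partial>gamma_measure (fst p))"
proof -
  interpret L: prob_space "gamma_convolution l"
    using assms by (intro prob_space_gamma_convolution) auto
  interpret G: prob_space "distr (gamma_measure (fst p)) borel ((*) (snd p))"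
    using assms(1)[of "fst p" "snd p"]
    by (intro prob_space.prob_space_distr prob_space_gamma_measure) auto
  have "(\<integral>\<^sup>+x. f x \<partial>gamma_convolution (p # l))
    = (\<integral>\<^sup>+x. \<integral>\<^sup>+y. f (x + y) \<partial>gamma_convolution l \<partial>distr (gamma_measure (fst p)) borel ((*) (snd p)))"
    unfolding gamma_convolution.simps
    by (intro nn_integral_convolution L.finite_measure_axioms G.finite_measure_axioms) auto
  also have "\<dots> = (\<integral>\<^sup>+x. \<integral>\<^sup>+y. f (snd p * x + y) \<partial>gamma_convolution l \<partial>gamma_measure (fst p))"
    by (subst nn_integral_distr) auto
  finally show ?thesis .
qed

text \<open>Adding a nonnegative head can only shrink the event that the sum is negative, so along
  the list its probability stays 0.\<close>

lemma AE_gamma_convolution_nonneg: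
  assumes "\<And>a c. (a, c) \<in> set l \<Longrightarrow> 0 < a \<and> 0 \<le> c"
  shows "AE x in gamma_convolution l. 0 \<le> x"
proof -
  have "(\<integral>\<^sup>+x. indicator {..<0} x \<partial>gamma_convolution l) = 0"
    using assms
  proof (induction l)
    case Nil
    then show ?case by (simp add: nn_integral_return)
  next
    case (Cons p l)
    have c: "0 \<le> snd p"
      using Cons.prems[of "fst p" "snd p"] by simp
    have "(\<integral>\<^sup>+x. indicator {..<0} x \<partial>gamma_convolution (p # l))
      = (\<integral>\<^sup>+x. \<integral>\<^sup>+y. indicator {..<0} (snd p * x + y) \<partial>gamma_convolution l \<partial>gamma_measure (fst p))"
      using Cons.prems by (intro nn_integral_gamma_convolution_Cons) auto
    also have "\<dots> \<le> (\<integral>\<^sup>+x. \<integral>\<^sup>+y. indicator {..<0} y \<partial>gamma_convolution l \<partial>gamma_measure (fst p))"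
    proof (intro nn_integral_mono_AE)
      show "AE x in gamma_measure (fst p). (\<integral>\<^sup>+y. indicator {..<0} (snd p * x + y) \<partial>gamma_convolution l)
        \<le> (\<integral>\<^sup>+y. indicator {..<0} y \<partial>gamma_convolution l)"
        using AE_gamma_measure_pos
      proof eventually_elim
        case (elim x)
        then have "0 \<le> snd p * x"
          using c by simp
        then show ?case
          by (intro nn_integral_mono) (auto simp: indicator_def)
      qed
    qed
    also have "\<dots> = 0"
      using Cons.IH[OF Cons.prems[OF list.set_intros(2)]] by simp
    finally show ?case by simp
  qed
  then show ?thesis
    by (subst (asm) nn_integral_0_iff_AE) (auto simp: indicator_def elim!: eventually_mono split: if_splits)
qed

text \<open>Independence makes the transform a product. The exponent is a Thorin exponent with an
  atom of mass a at 1 / c for each entry with c > 0.\<close>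

lemma nn_integral_gamma_convolution_exp:
  assumes "\<And>a c. (a, c) \<in> set l \<Longrightarrow> 0 < a \<and> 0 \<le> c" and s: "0 \<le> s"
  shows "(\<integral>\<^sup>+x. ennreal (exp (- (s * x))) \<partial>gamma_convolution l)
    = ennreal (exp (- (\<Sum>(a, c) \<leftarrow> l. a * ln (1 + s * c))))"
  using assms(1)
proof (induction l)
  case Nil
  then show ?case by (simp add: nn_integral_return)
next
  case (Cons p l)
  have p: "0 < fst p" "0 \<le> snd p"
    using Cons.prems[of "fst p" "snd p"] by simp_all
  let ?S = "\<Sum>(a, c) \<leftarrow> l. a * ln (1 + s * c)"
  have "(\<integral>\<^sup>+x. ennreal (exp (- (s * x))) \<partial>gamma_convolution (p # l))
    = (\<integral>\<^sup>+x. \<integral>\<^sup>+y. ennreal (exp (- (s * (snd p * x + y)))) \<partial>gamma_convolution l \<partial>gamma_measure (fst p))"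
    using Cons.prems by (intro nn_integral_gamma_convolution_Cons) auto
  also have "\<dots> = (\<integral>\<^sup>+x. \<integral>\<^sup>+y. ennreal (exp (- (s * snd p * x))) * ennreal (exp (- (s * y)))
      \<partial>gamma_convolution l \<partial>gamma_measure (fst p))"
    by (simp add: ennreal_mult''[symmetric] mult_exp_exp algebra_simps)
  also have "\<dots> = (\<integral>\<^sup>+x. ennreal (exp (- (s * snd p * x))) * ennreal (exp (- ?S)) \<partial>gamma_measure (fst p))"
    by (simp add: nn_integral_cmult Cons.IH[OF Cons.prems[OF list.set_intros(2)]])
  also have "\<dots> = ennreal (exp (- (fst p * ln (1 + s * snd p)))) * ennreal (exp (- ?S))"
    using p s by (simp add: nn_integral_multc nn_integral_gamma_measure_exp)
  also have "\<dots> = ennreal (exp (- (\<Sum>(a, c) \<leftarrow> p # l. a * ln (1 + s * c))))"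
    by (simp add: ennreal_mult''[symmetric] mult_exp_exp case_prod_unfold)
  finally show ?case .
qed

lemma convex_on_UNIV_translate:
  fixes \<psi> :: "real \<Rightarrow> real"
  assumes "convex_on UNIV \<psi>"
  shows "convex_on UNIV (\<lambda>y. \<psi> (x + y))"
proof (intro convex_onI)
  fix t y z :: real
  assume t: "0 < t" "t < 1"
  have "x + ((1 - t) *\<^sub>R y + t *\<^sub>R z) = (1 - t) *\<^sub>R (x + y) + t *\<^sub>R (x + z)"
    by (simp add: algebra_simps)
  then show "\<psi> (x + ((1 - t) *\<^sub>R y + t *\<^sub>R z)) \<le> (1 - t) * \<psi> (x + y) + t * \<psi> (x + z)"
    using convex_onD[OF assms, of t "x + y" "x + z"] t by simp
qed simp

text \<open>Induction on the list: the tail collapses to one gamma variable, which is then merged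
  with the head. The test function is kept arbitrary since the tail is treated under translates of
  \<psi>.\<close>

lemma nn_integral_gamma_le_gamma_convolution:
  fixes \<psi> :: "real \<Rightarrow> real"
  assumes "l \<noteq> []" "\<And>a c. (a, c) \<in> set l \<Longrightarrow> 0 < a"
    and "convex_on UNIV \<psi>" "\<And>x. 0 \<le> \<psi> x"
  shows "(\<integral>\<^sup>+u. ennreal (\<psi> (u * ((\<Sum>(a, c) \<leftarrow> l. a * c) / (\<Sum>(a, c) \<leftarrow> l. a))))
      \<partial>gamma_measure (\<Sum>(a, c) \<leftarrow> l. a))
    \<le> (\<integral>\<^sup>+x. ennreal (\<psi> x) \<partial>gamma_convolution l)"
  using assms
proof (induction l arbitrary: \<psi> rule: list_nonempty_induct)
  case (single p)
  have a: "0 < fst p"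
    using single.prems(1)[of "fst p" "snd p"] by simp
  have [measurable]: "\<psi> \<in> borel_measurable borel"
    using single by (intro convex_on_UNIV_measurable)
  have "(\<integral>\<^sup>+x. ennreal (\<psi> x) \<partial>gamma_convolution [p])
    = (\<integral>\<^sup>+x. \<integral>\<^sup>+y. ennreal (\<psi> (snd p * x + y)) \<partial>gamma_convolution [] \<partial>gamma_measure (fst p))"
    using single.prems by (intro nn_integral_gamma_convolution_Cons) auto
  also have "\<dots> = (\<integral>\<^sup>+x. ennreal (\<psi> (snd p * x)) \<partial>gamma_measure (fst p))"
    by (simp add: nn_integral_return)
  finally show ?case
    using a by (simp add: case_prod_unfold mult.commute)
next
  case (cons p l)
  let ?D = "\<Sum>(a, c) \<leftarrow> l. a" and ?m = "\<Sum>(a, c) \<leftarrow> l. a * c"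
  have a: "0 < fst p"
    using cons.prems(1)[of "fst p" "snd p"] by simp
  have [measurable]: "\<psi> \<in> borel_measurable borel"
    using cons by (intro convex_on_UNIV_measurable)
  have D: "0 < ?D"
  proof -
    obtain q l' where "l = q # l'"
      using cons.hyps by (cases l) auto
    moreover have "0 \<le> (\<Sum>(a, c) \<leftarrow> l'. a)"
      using cons.prems(1) \<open>l = q # l'\<close> by (intro sum_list_nonneg) force
    ultimately show ?thesis
      using cons.prems(1)[of "fst q" "snd q"] by (simp add: case_prod_unfold)
  qed
  have "(\<integral>\<^sup>+u. ennreal (\<psi> (u * ((fst p * snd p + ?D * (?m / ?D)) / (fst p + ?D)))) \<partial>gamma_measure (fst p + ?D))
    \<le> (\<integral>\<^sup>+x. \<integral>\<^sup>+y. ennreal (\<psi> (snd p * x + ?m / ?D * y)) \<partial>gamma_measure ?D \<partial>gamma_measure (fst p))"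
    \<comment> \<open>The second variable has shape \<open>?D\<close> and scale
      \<open>?m / ?D\<close>, hence the total shape and the mean of the tail.\<close>
    using a D cons.prems by (intro nn_integral_gamma_merge)
  also have "\<dots> \<le> (\<integral>\<^sup>+x. \<integral>\<^sup>+y. ennreal (\<psi> (snd p * x + y)) \<partial>gamma_convolution l \<partial>gamma_measure (fst p))"
  \<comment> \<open>With the head x fixed, the induction hypothesis applies to the convex function
    \<open>\<lambda>y. \<psi> (snd p * x + y)\<close>.\<close>
  proof (intro nn_integral_mono)
    fix x
    show "(\<integral>\<^sup>+y. ennreal (\<psi> (snd p * x + ?m / ?D * y)) \<partial>gamma_measure ?D)
      \<le> (\<integral>\<^sup>+y. ennreal (\<psi> (snd p * x + y)) \<partial>gamma_convolution l)"
      using cons.IH[OF cons.prems(1)[OF list.set_intros(2)] convex_on_UNIV_translate[OF cons.prems(2)]]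
        cons.prems(3)
      by (simp add: mult.commute)
  qed
  also have "\<dots> = (\<integral>\<^sup>+x. ennreal (\<psi> x) \<partial>gamma_convolution (p # l))"
    using cons.prems by (intro nn_integral_gamma_convolution_Cons[symmetric]) auto
  finally show ?case
    using D by (simp add: case_prod_unfold)
qed

section \<open>Convergence of moments on the unit interval\<close>

text \<open>By Weierstrass a polynomial is within e / 3 of f on [0,1]. Its expectations are linear
  combinations of moments and so converge; the remaining 2 e / 3 covers the replacement of f on both
  sides.\<close>

lemma moments_convergence_imp_continuous:
  fixes Y :: "nat \<Rightarrow> 'a \<Rightarrow> real" and Z :: "'b \<Rightarrow> real" and f :: "real \<Rightarrow> real"
  assumes N: "\<And>n. prob_space (N n)" and M: "prob_space M"
    and [measurable]: "\<And>n. Y n \<in> borel_measurable (N n)" "Z \<in> borel_measurable M"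
    and Y: "\<And>n. AE x in N n. Y n x \<in> {0..1}" and Z: "AE x in M. Z x \<in> {0..1}"
    and lim: "\<And>j. (\<lambda>n. \<integral>x. Y n x ^ j \<partial>N n) \<longlonglongrightarrow> (\<integral>x. Z x ^ j \<partial>M)"
    and f: "continuous_on UNIV f"
  shows "(\<lambda>n. \<integral>x. f (Y n x) \<partial>N n) \<longlonglongrightarrow> (\<integral>x. f (Z x) \<partial>M)"
proof (rule LIMSEQ_I)
  fix e :: real
  assume e: "0 < e"
  have [measurable]: "f \<in> borel_measurable borel"
    using f by (rule borel_measurable_continuous_onI)
  have "continuous_on {0..1} f"
    using f continuous_on_subset by blast
  then obtain p where "real_polynomial_function p" and p: "\<And>y. y \<in> {0..1} \<Longrightarrow> \<bar>f y - p y\<bar> < e / 3"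
    using Stone_Weierstrass_real_polynomial_function[of "{0..1::real}" f "e / 3"] e by auto
  then obtain a m where p_def: "p = (\<lambda>y. \<Sum>i\<le>(m::nat). a i * y ^ i)"
    unfolding real_polynomial_function_iff_sum by auto
  have [measurable]: "p \<in> borel_measurable borel"
    unfolding p_def by measurable
  \<comment> \<open>Stated for an arbitrary probability space, since it serves both the
    approximating variables and the limit.\<close>
  have approx: "\<bar>(\<integral>x. f (V x) \<partial>P) - (\<integral>x. p (V x) \<partial>P)\<bar> \<le> e / 3"
    and poly: "(\<integral>x. p (V x) \<partial>P) = (\<Sum>i\<le>m. a i * (\<integral>x. V x ^ i \<partial>P))"
    if P: "prob_space P" and [measurable]: "V \<in> borel_measurable P"
      and V: "AE x in P. V x \<in> {0..1}" for P :: "'c measure" and V :: "'c \<Rightarrow> real"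
  proof -
    interpret P: prob_space P by fact
    have pow: "integrable P (\<lambda>x. V x ^ i)" for i
    proof (rule P.integrable_const_bound[where B=1])
      show "AE x in P. norm (V x ^ i) \<le> 1"
        using V by (rule eventually_mono) (simp add: power_le_one power_abs)
    qed measurable
    then have ip: "integrable P (\<lambda>x. p (V x))"
      unfolding p_def by auto
    have "AE x in P. \<bar>f (V x) - p (V x)\<bar> \<le> e / 3"
      using V by eventually_elim (use p in \<open>auto intro: less_imp_le\<close>)
    then have id: "integrable P (\<lambda>x. f (V x) - p (V x))"
      by (intro P.integrable_const_bound[where B="e / 3"]) auto
    then have "integrable P (\<lambda>x. f (V x))"
      using Bochner_Integration.integrable_add[OF id ip] by simp
    then have "(\<integral>x. f (V x) \<partial>P) - (\<integral>x. p (V x) \<partial>P) = (\<integral>x. f (V x) - p (V x) \<partial>P)"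
      using ip by simp
    also have "\<bar>\<dots>\<bar> \<le> (\<integral>x. \<bar>f (V x) - p (V x)\<bar> \<partial>P)"
      by (rule integral_abs_bound)
    also have "\<dots> \<le> e / 3"
      using \<open>AE x in P. _ \<le> e / 3\<close> id by (intro P.integral_le_const) auto
    finally show "\<bar>(\<integral>x. f (V x) \<partial>P) - (\<integral>x. p (V x) \<partial>P)\<bar> \<le> e / 3" .
    show "(\<integral>x. p (V x) \<partial>P) = (\<Sum>i\<le>m. a i * (\<integral>x. V x ^ i \<partial>P))"
      unfolding p_def using pow by (subst Bochner_Integration.integral_sum) auto
  qed
  have "(\<lambda>n. \<Sum>i\<le>m. a i * (\<integral>x. Y n x ^ i \<partial>N n)) \<longlonglongrightarrow> (\<Sum>i\<le>m. a i * (\<integral>x. Z x ^ i \<partial>M))"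
    by (intro tendsto_intros lim)
  then have "(\<lambda>n. \<integral>x. p (Y n x) \<partial>N n) \<longlonglongrightarrow> (\<integral>x. p (Z x) \<partial>M)"
    using poly[OF N _ Y] poly[OF M _ Z] by simp
  moreover have "0 < e / 3"
    using e by simp
  ultimately obtain n0 where
    n0: "\<And>n. n0 \<le> n \<Longrightarrow> norm ((\<integral>x. p (Y n x) \<partial>N n) - (\<integral>x. p (Z x) \<partial>M)) < e / 3"
    using LIMSEQ_D by blast
  have triangle: "\<bar>u - v\<bar> < e" if "\<bar>u - p\<bar> \<le> e / 3" "\<bar>p - q\<bar> < e / 3" "\<bar>v - q\<bar> \<le> e / 3" for u v p q :: real
    using that by arith
  have "norm ((\<integral>x. f (Y n x) \<partial>N n) - (\<integral>x. f (Z x) \<partial>M)) < e" if "n0 \<le> n" for n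
    using triangle[OF approx[OF N _ Y, of n] n0[OF that, unfolded real_norm_def] approx[OF M _ Z]]
    by simp
  then show "\<exists>n0. \<forall>n\<ge>n0. norm ((\<integral>x. f (Y n x) \<partial>N n) - (\<integral>x. f (Z x) \<partial>M)) < e"
    by blast
qed

subsection \<open>Approximation of generalized gamma convolutions\<close>

text \<open>The image of \<mu> under h is a finite sum of atoms, listed here as pairs of mass and
  position. Values taken on null sets are dropped so that all masses are valid gamma shapes. Leaving
  F free gives the total shape, the mean and the Laplace exponent from one identity.\<close>

lemma simple_function_integral_weights:
  fixes h :: "'a \<Rightarrow> real"
  assumes \<mu>: "finite_measure \<mu>" and h: "simple_function \<mu> h"
  obtains l :: "(real \<times> real) list"
  where "\<And>a c. (a, c) \<in> set l \<Longrightarrow> 0 < a \<and> c \<in> h ` space \<mu>"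
    and "\<And>F :: real \<Rightarrow> real. (\<Sum>(a, c) \<leftarrow> l. a * F c) = (\<integral>u. F (h u) \<partial>\<mu>)"
proof -
  interpret finite_measure \<mu> by fact
  let ?S = "space \<mu>"
  let ?A = "\<lambda>c. h -` {c} \<inter> ?S"
  have fin: "finite (h ` ?S)" and meas: "\<And>c. c \<in> h ` ?S \<Longrightarrow> ?A c \<in> sets \<mu>"
    using h by (auto simp: simple_function_def)
  obtain cs where cs: "distinct cs" "set cs = {c \<in> h ` ?S. 0 < measure \<mu> (?A c)}"
    using finite_distinct_list[of "{c \<in> h ` ?S. 0 < measure \<mu> (?A c)}"] fin by auto
  show thesis
  proof
    let ?l = "map (\<lambda>c. (measure \<mu> (?A c), c)) cs"
    show "0 < a \<and> c \<in> h ` ?S" if "(a, c) \<in> set ?l" for a c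
      using that cs(2) by auto
    fix F :: "real \<Rightarrow> real"
    have "(\<Sum>(a, c) \<leftarrow> ?l. a * F c) = (\<Sum>c\<in>set cs. measure \<mu> (?A c) * F c)"
      by (simp add: comp_def sum_list_distinct_conv_sum_set[OF cs(1)])
    also have "\<dots> = (\<Sum>c\<in>h ` ?S. measure \<mu> (?A c) * F c)"
      using fin cs(2) by (intro sum.mono_neutral_left) (auto simp: less_le)
    also have "\<dots> = (\<Sum>c\<in>h ` ?S. (\<integral>u. indicator (?A c) u * F c \<partial>\<mu>))"
      using meas by (intro sum.cong) auto
    also have "\<dots> = (\<integral>u. (\<Sum>c\<in>h ` ?S. indicator (?A c) u * F c) \<partial>\<mu>)"
      using meas by (intro Bochner_Integration.integral_sum[symmetric] integrable_mult_left
          integrable_real_indicator) (auto simp: less_top[symmetric])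
    also have "\<dots> = (\<integral>u. F (h u) \<partial>\<mu>)"
    proof (intro Bochner_Integration.integral_cong refl)
      fix u
      assume u: "u \<in> ?S"
      have "(\<Sum>c\<in>h ` ?S. indicator (?A c) u * F c) = (\<Sum>c\<in>h ` ?S. if c = h u then F c else 0)"
        using u by (intro sum.cong) (auto simp: indicator_def)
      also have "\<dots> = F (h u)"
        using fin u by (simp add: sum.delta')
      finally show "(\<Sum>c\<in>h ` ?S. indicator (?A c) u * F c) = F (h u)" .
    qed
    finally show "(\<Sum>(a, c) \<leftarrow> ?l. a * F c) = (\<integral>u. F (h u) \<partial>\<mu>)" .
  qed
qed

lemma ggcD:
  assumes "ggc M X \<mu>"
  shows "X \<in> borel_measurable M" "AE \<omega> in M. 0 \<le> X \<omega>" "thorin_measure \<mu>"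
    "\<And>s. 0 \<le> s \<Longrightarrow> integrable \<mu> (\<lambda>u. ln (1 + s / u))"
    "\<And>s. 0 \<le> s \<Longrightarrow> (\<integral>\<omega>. exp (- s * X \<omega>) \<partial>M) = exp (- (\<integral>u. ln (1 + s / u) \<partial>\<mu>))"
  using assms unfolding ggc_def by auto

lemma thorin_measureD:
  assumes "thorin_measure \<mu>"
  shows "sets \<mu> = sets (restrict_space borel {0<..})" "space \<mu> = {0<..}"
    "emeasure \<mu> (space \<mu>) \<noteq> 0"
proof -
  show s: "sets \<mu> = sets (restrict_space borel {0<..})"
    using assms by (simp add: thorin_measure_def)
  show "space \<mu> = {0<..}"
    using sets_eq_imp_space_eq[OF s] by (simp add: space_restrict_space)
  show "emeasure \<mu> (space \<mu>) \<noteq> 0"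
    using assms by (simp add: thorin_measure_def)
qed

lemma measurable_half_line:
  assumes "sets \<mu> = sets (restrict_space borel {0<..})" "f \<in> borel_measurable borel"
  shows "f \<in> borel_measurable \<mu>"
  using measurable_restrict_space1[OF assms(2)] measurable_cong_sets[OF assms(1) refl] by blast

text \<open>Equality holds, but Jensen's bound \<open>exp (- s E X) \<le> E (exp (- s X))\<close>, divided by \<open>s\<close> with
  \<open>s \<rightarrow> 0\<close>, gives this half without differentiating the Laplace transform.\<close>

lemma ggc_inverse_moment_le:
  assumes M: "prob_space M" and X: "ggc M X \<mu>" and int: "integrable M X"
  shows "(\<integral>\<^sup>+u. ennreal (1 / u) \<partial>\<mu>) \<le> ennreal (\<integral>\<omega>. X \<omega> \<partial>M)"
proof -
  interpret prob_space M by fact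
  note [measurable] = ggcD(1)[OF X]
  note \<mu> = thorin_measureD[OF ggcD(3)[OF X]]
  let ?E = "\<integral>\<omega>. X \<omega> \<partial>M"
  let ?f = "\<lambda>n u. real n * ln (1 + (1 / real n) / u)"
  have meas: "(\<lambda>u. ennreal (?f n u)) \<in> borel_measurable \<mu>" for n
    by (intro measurable_half_line[OF \<mu>(1)]) measurable
  have bound: "(\<integral>\<^sup>+u. ennreal (?f n u) \<partial>\<mu>) \<le> ennreal ?E" if n: "0 < n" for n
  proof -
    let ?s = "1 / real n"
    have i: "integrable \<mu> (\<lambda>u. ln (1 + ?s / u))"
      by (intro ggcD(4)[OF X]) simp
    have e: "integrable M (\<lambda>\<omega>. exp (- ?s * X \<omega>))"
      using ggcD(2)[OF X] n by (intro integrable_const_bound[where B=1])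
        (auto elim!: eventually_mono)
    \<comment> \<open>Jensen through the tangent line of exp at \<open>- ?s * ?E\<close>: the linear
      term has expectation 0.\<close>
    have "exp (- ?s * ?E) = (\<integral>\<omega>. exp (- ?s * ?E) * (1 - ?s * (X \<omega> - ?E)) \<partial>M)"
      using int by (simp add: prob_space)
    also have "\<dots> \<le> (\<integral>\<omega>. exp (- ?s * X \<omega>) \<partial>M)"
    proof (intro integral_mono e)
      fix \<omega>
      have "exp (- ?s * ?E) * (1 - ?s * (X \<omega> - ?E)) \<le> exp (- ?s * ?E) * exp (- ?s * (X \<omega> - ?E))"
        using exp_ge_add_one_self[of "- ?s * (X \<omega> - ?E)"] by (intro mult_left_mono) auto
      also have "\<dots> = exp (- ?s * X \<omega>)"
        by (simp add: mult_exp_exp algebra_simps flip: add_divide_distrib)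
      finally show "exp (- ?s * ?E) * (1 - ?s * (X \<omega> - ?E)) \<le> exp (- ?s * X \<omega>)" .
    qed (use int in auto)
    also have "\<dots> = exp (- (\<integral>u. ln (1 + ?s / u) \<partial>\<mu>))"
      using ggcD(5)[OF X, of ?s] by simp
    finally have "real n * (\<integral>u. ln (1 + ?s / u) \<partial>\<mu>) \<le> ?E"
      using n by (simp add: field_simps)
    moreover have "(\<integral>\<^sup>+u. ennreal (?f n u) \<partial>\<mu>) = ennreal (\<integral>u. ?f n u \<partial>\<mu>)"
      using i \<mu>(2) by (intro nn_integral_eq_integral integrable_mult_right AE_I2) auto
    ultimately show ?thesis
      by (simp add: ennreal_leI)
  qed
  have "(\<integral>\<^sup>+u. ennreal (1 / u) \<partial>\<mu>) = (\<integral>\<^sup>+u. liminf (\<lambda>n. ennreal (?f n u)) \<partial>\<mu>)"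
  \<comment> \<open>With s = 1 / n the quotient is n ln (1 + 1 / (n u)), the logarithm of a sequence
    tending to exp (1 / u). Fatou's lemma then transfers the uniform bound to 1 / u.\<close>
  proof (intro nn_integral_cong)
    fix u
    assume "u \<in> space \<mu>"
    then have u: "0 < u"
      using \<mu>(2) by simp
    have "(\<lambda>n. ln ((1 + (1 / u) / real n) ^ n)) \<longlonglongrightarrow> ln (exp (1 / u))"
      by (intro tendsto_ln tendsto_exp_limit_sequentially) simp
    moreover have "ln ((1 + (1 / u) / real n) ^ n) = ?f n u" for n
      using u by (subst ln_realpow) (auto intro: add_pos_nonneg simp: mult.commute)
    ultimately have "(\<lambda>n. ennreal (?f n u)) \<longlonglongrightarrow> ennreal (1 / u)"
      by (intro tendsto_ennrealI) simp
    then show "ennreal (1 / u) = liminf (\<lambda>n. ennreal (?f n u))"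
      by (intro lim_imp_Liminf[symmetric]) auto
  qed
  also have "\<dots> \<le> liminf (\<lambda>n. \<integral>\<^sup>+u. ennreal (?f n u) \<partial>\<mu>)"
    by (intro nn_integral_liminf meas)
  also have "\<dots> \<le> liminf (\<lambda>n::nat. ennreal ?E)"
    using bound by (intro Liminf_mono) (auto intro!: eventually_sequentiallyI[of 1])
  also have "\<dots> = ennreal ?E"
    by (intro lim_imp_Liminf) auto
  finally show ?thesis .
qed

text \<open>The approximants all have shape D exactly, but only a bound 1 on the mean, which is why
  \<psi> must decrease. That \<psi> vanishes beyond K makes it a continuous function of exp (- x) up
  to the endpoint 0.\<close>

lemma gamma_le_ggc_of_decreasing:
  fixes \<psi> :: "real \<Rightarrow> real"
  assumes M: "prob_space M" and X: "ggc M X \<mu>" and mass: "thorin_mass \<mu> < \<infinity>"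
    and int: "integrable M X" and mean: "(\<integral>\<omega>. X \<omega> \<partial>M) = 1"
    and cvx: "convex_on UNIV \<psi>" and nonneg: "\<And>x. 0 \<le> \<psi> x"
    and anti: "antimono \<psi>" and vanish: "\<And>x. K \<le> x \<Longrightarrow> \<psi> x = 0"
  defines "D \<equiv> enn2real (thorin_mass \<mu>)"
  shows "(\<integral>u. \<psi> (u / D) \<partial>gamma_measure D) \<le> (\<integral>\<omega>. \<psi> (X \<omega>) \<partial>M)"
proof -
  interpret prob_space M by fact
  note [measurable] = ggcD(1)[OF X]
  note \<mu> = thorin_measureD[OF ggcD(3)[OF X]]
  have [measurable]: "\<psi> \<in> borel_measurable borel"
    using cvx by (rule convex_on_UNIV_measurable)
  interpret \<mu>: finite_measure \<mu>
    using mass by (intro finite_measureI) (simp add: thorin_mass_def less_top)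
  have D_eq: "D = measure \<mu> (space \<mu>)"
    by (simp add: D_def thorin_mass_def measure_def)
  have D: "0 < D"
    using \<mu>(3) by (simp add: D_eq \<mu>.emeasure_eq_measure zero_less_measure_iff)
  interpret \<Gamma>: prob_space "gamma_measure D"
    using D by (rule prob_space_gamma_measure)

  have "(\<lambda>u. ennreal (1 / u)) \<in> borel_measurable \<mu>"
    by (intro measurable_half_line[OF \<mu>(1)]) measurable
  then obtain \<phi> where \<phi>: "\<And>i. simple_function \<mu> (\<phi> i)" "incseq \<phi>" "\<And>i u. \<phi> i u < top"
    "\<And>u. (SUP i. \<phi> i u) = ennreal (1 / u)"
    by (rule borel_measurable_implies_simple_function_sequence') blast
  define h where "h i u = enn2real (\<phi> i u)" for i u
  have h_simple: "simple_function \<mu> (h i)" for i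
    unfolding h_def using \<phi>(1) by (rule simple_function_compose1)
  have [measurable]: "h i \<in> borel_measurable \<mu>" for i
    using h_simple by (rule borel_measurable_simple_function)
  have ennreal_h: "ennreal (h i u) = \<phi> i u" for i u
    using \<phi>(3)[of i u] by (simp add: h_def)
  have h_nonneg: "0 \<le> h i u" for i u
    by (simp add: h_def)
  have h_le: "h i u \<le> 1 / u" if "u \<in> space \<mu>" for i u
  proof -
    have "ennreal (h i u) \<le> ennreal (1 / u)"
      unfolding ennreal_h \<phi>(4)[symmetric] by (rule SUP_upper) simp
    then show ?thesis
      using that \<mu>(2) by (subst (asm) ennreal_le_iff) auto
  qed
  have h_lim: "(\<lambda>i. h i u) \<longlonglongrightarrow> 1 / u" if "u \<in> space \<mu>" for u
  proof -
    have "(\<lambda>i. \<phi> i u) \<longlonglongrightarrow> (SUP i. \<phi> i u)"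
      using \<phi>(2) by (intro LIMSEQ_SUP) (auto simp: incseq_def le_fun_def)
    then have "(\<lambda>i. ennreal (h i u)) \<longlonglongrightarrow> ennreal (1 / u)"
      by (simp only: \<phi>(4) ennreal_h)
    then show ?thesis
      using that \<mu>(2) h_nonneg by (subst (asm) tendsto_ennreal_iff) auto
  qed
  \<comment> \<open>The approximation is from below, so the bound on the integral of 1 / u passes to
    every \<open>h i\<close>.\<close>
  have h_mean: "(\<integral>u. h i u \<partial>\<mu>) \<le> 1" for i
  proof -
    have "(\<integral>\<^sup>+u. ennreal (h i u) \<partial>\<mu>) \<le> (\<integral>\<^sup>+u. ennreal (1 / u) \<partial>\<mu>)"
      using h_le by (intro nn_integral_mono ennreal_leI) auto
    also have "\<dots> \<le> 1"
      using ggc_inverse_moment_le[OF M X int] mean by simp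
    finally show ?thesis
      using h_nonneg by (simp add: integral_eq_nn_integral enn2real_leI)
  qed

  \<comment> \<open>One list for each i, whose atoms represent the image of \<mu> under
    \<open>h i\<close>.\<close>
  define l where "l i = (SOME l :: (real \<times> real) list.
    (\<forall>a c. (a, c) \<in> set l \<longrightarrow> 0 < a \<and> c \<in> h i ` space \<mu>) \<and>
    (\<forall>F :: real \<Rightarrow> real. (\<Sum>(a, c) \<leftarrow> l. a * F c) = (\<integral>u. F (h i u) \<partial>\<mu>)))" for i
  have l_ex: "(\<forall>a c. (a, c) \<in> set (l i) \<longrightarrow> 0 < a \<and> c \<in> h i ` space \<mu>) \<and>
    (\<forall>F :: real \<Rightarrow> real. (\<Sum>(a, c) \<leftarrow> l i. a * F c) = (\<integral>u. F (h i u) \<partial>\<mu>))" for i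
    unfolding l_def
    by (rule someI_ex, rule simple_function_integral_weights[OF \<mu>.finite_measure_axioms h_simple[of i]]) blast
  have l: "0 < a \<and> c \<in> h i ` space \<mu>" if "(a, c) \<in> set (l i)" for i a c
    using l_ex that by blast
  have l_sum: "(\<Sum>(a, c) \<leftarrow> l i. a * F c) = (\<integral>u. F (h i u) \<partial>\<mu>)" for i and F :: "real \<Rightarrow> real"
    using l_ex by blast
  have l_pos: "0 < a \<and> 0 \<le> c" if "(a, c) \<in> set (l i)" for i a c
    using l[OF that] h_nonneg by auto
  \<comment> \<open>The constant function 1 shows that every approximant has total shape D, so the
    gamma variable compared with it does not depend on i.\<close>
  have l_mass: "(\<Sum>(a, c) \<leftarrow> l i. a) = D" for i
    using l_sum[of "\<lambda>_. 1" i] by (simp add: D_eq)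
  have l_ne: "l i \<noteq> []" for i
    using l_mass[of i] D by auto
  let ?N = "\<lambda>i. gamma_convolution (l i)"
  have N: "prob_space (?N i)" for i
    using l_pos by (intro prob_space_gamma_convolution) auto
  have N_nonneg: "AE x in ?N i. 0 \<le> x" for i
    using l_pos by (intro AE_gamma_convolution_nonneg) auto

  \<comment> \<open>The j-th moment of exp (- x) is the Laplace transform at s = j. The exponents
    converge by domination with ln (1 + j / u), integrable by the definition of a GGC.\<close>
  have laplace: "(\<lambda>i. \<integral>x. exp (- x) ^ j \<partial>?N i) \<longlonglongrightarrow> (\<integral>\<omega>. exp (- X \<omega>) ^ j \<partial>M)" for j :: nat
  proof -
    have "(\<lambda>i. \<integral>u. ln (1 + real j * h i u) \<partial>\<mu>) \<longlonglongrightarrow> (\<integral>u. ln (1 + real j * (1 / u)) \<partial>\<mu>)"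
    proof (rule integral_dominated_convergence[where w = "\<lambda>u. ln (1 + real j / u)"])
      show "(\<lambda>u. ln (1 + real j * (1 / u))) \<in> borel_measurable \<mu>"
        by (intro measurable_half_line[OF \<mu>(1)]) measurable
      show "AE u in \<mu>. (\<lambda>i. ln (1 + real j * h i u)) \<longlonglongrightarrow> ln (1 + real j * (1 / u))"
      proof (intro AE_I2 tendsto_ln tendsto_intros h_lim)
        fix u
        assume "u \<in> space \<mu>"
        then have "0 \<le> real j * (1 / u)"
          using \<mu>(2) by simp
        then show "1 + real j * (1 / u) \<noteq> 0"
          by linarith
      qed
      show "AE u in \<mu>. norm (ln (1 + real j * h i u)) \<le> ln (1 + real j / u)" for i
      proof (intro AE_I2)
        fix u
        assume u: "u \<in> space \<mu>"
        have "0 \<le> real j * h i u" "real j * h i u \<le> real j * (1 / u)"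
          using h_nonneg h_le[OF u] by (auto intro: mult_left_mono simp del: times_divide_eq_right)
        then show "norm (ln (1 + real j * h i u)) \<le> ln (1 + real j / u)"
          by simp
      qed
    qed (use ggcD(4)[OF X] in auto)
    then have "(\<lambda>i. exp (- (\<integral>u. ln (1 + real j * h i u) \<partial>\<mu>)))
      \<longlonglongrightarrow> exp (- (\<integral>u. ln (1 + real j / u) \<partial>\<mu>))"
      by (intro tendsto_intros) simp
    moreover have "(\<integral>x. exp (- x) ^ j \<partial>?N i) = exp (- (\<integral>u. ln (1 + real j * h i u) \<partial>\<mu>))" for i
    proof -
      have "(\<integral>x. exp (- x) ^ j \<partial>?N i) = enn2real (\<integral>\<^sup>+x. ennreal (exp (- (real j * x))) \<partial>?N i)"
        by (subst integral_eq_nn_integral) (auto simp: exp_of_nat_mult[symmetric])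
      also have "\<dots> = exp (- (\<Sum>(a, c) \<leftarrow> l i. a * ln (1 + real j * c)))"
        using l_pos by (subst nn_integral_gamma_convolution_exp) auto
      finally show ?thesis
        by (simp add: l_sum)
    qed
    moreover have "(\<integral>\<omega>. exp (- X \<omega>) ^ j \<partial>M) = exp (- (\<integral>u. ln (1 + real j / u) \<partial>\<mu>))"
      using ggcD(5)[OF X, of "real j"] by (simp add: exp_of_nat_mult[symmetric])
    ultimately show ?thesis
      by simp
  qed

  \<comment> \<open>Truncating at \<open>exp (- K)\<close> makes \<open>f\<close> continuous at 0 and is harmless since \<open>\<psi>\<close> vanishes beyond \<open>K\<close>.\<close>
  define f where "f y = \<psi> (- ln (max y (exp (- K))))" for y
  have f_exp: "f (exp (- x)) = \<psi> x" for x
  proof (cases "x \<le> K")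
    case False
    then show ?thesis
      using vanish[of x] vanish[of K] by (simp add: f_def max_def)
  qed (simp add: f_def max_def)
  have "continuous_on UNIV f"
    unfolding f_def
    by (intro continuous_on_compose2[OF convex_on_continuous[OF open_UNIV cvx]] continuous_intros)
       (auto simp: max_def)
  have "(\<lambda>i. \<integral>x. f (exp (- x)) \<partial>?N i) \<longlonglongrightarrow> (\<integral>\<omega>. f (exp (- X \<omega>)) \<partial>M)"
  proof (rule moments_convergence_imp_continuous[OF N M _ _ _ _ laplace \<open>continuous_on UNIV f\<close>])
    show "AE x in ?N i. exp (- x) \<in> {0..1}" for i
      using N_nonneg by (rule eventually_mono) simp
    show "AE \<omega> in M. exp (- X \<omega>) \<in> {0..1}"
      using ggcD(2)[OF X] by (rule eventually_mono) simp
  qed auto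
  then have lim: "(\<lambda>i. \<integral>x. \<psi> x \<partial>?N i) \<longlonglongrightarrow> (\<integral>\<omega>. \<psi> (X \<omega>) \<partial>M)"
    by (simp add: f_exp)
  have lower: "(\<integral>u. \<psi> (u / D) \<partial>gamma_measure D) \<le> (\<integral>x. \<psi> x \<partial>?N i)" for i
  proof -
    interpret N: prob_space "?N i" by (rule N)
    have iN: "integrable (?N i) \<psi>"
      using N_nonneg[of i] antimonoD[OF anti] nonneg
      by (intro N.integrable_const_bound[where B = "\<psi> 0"]) (auto elim!: eventually_mono)
    have i\<Gamma>: "integrable (gamma_measure D) (\<lambda>u. \<psi> (u / D))"
      using AE_gamma_measure_pos[of D] antimonoD[OF anti] nonneg D
      by (intro \<Gamma>.integrable_const_bound[where B = "\<psi> 0"]) (auto elim!: eventually_mono)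
    have "(\<integral>\<^sup>+u. ennreal (\<psi> (u / D)) \<partial>gamma_measure D)
      \<le> (\<integral>\<^sup>+u. ennreal (\<psi> (u * ((\<integral>u. h i u \<partial>\<mu>) / D))) \<partial>gamma_measure D)"
    \<comment> \<open>The mean of \<open>h i\<close> is at most 1, so for u > 0 the right-hand
      argument is the smaller one, and \<psi> decreases.\<close>
    proof (intro nn_integral_mono_AE, use AE_gamma_measure_pos[of D] in eventually_elim)
      case (elim u)
      then have "u * (\<integral>u. h i u \<partial>\<mu>) \<le> u * 1"
        using h_mean[of i] by (intro mult_left_mono) auto
      then have "u * ((\<integral>u. h i u \<partial>\<mu>) / D) \<le> u / D"
        using D by (simp add: divide_right_mono)
      then show ?case
        by (intro ennreal_leI antimonoD[OF anti])
    qed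
    also have "\<dots> \<le> (\<integral>\<^sup>+x. ennreal (\<psi> x) \<partial>?N i)"
      using nn_integral_gamma_le_gamma_convolution[OF l_ne, of i \<psi>] l_pos cvx nonneg
        l_sum[of "\<lambda>c. c" i]
      by (simp add: l_mass)
    finally show ?thesis
      using iN i\<Gamma> nonneg by (simp add: nn_integral_eq_integral)
  qed
  show ?thesis
    by (rule LIMSEQ_le_const[OF lim]) (use lower in auto)
qed

subsection \<open>General convex test functions\<close>

text \<open>The supporting line at w = (1 - t) x + t y lies below f at x and y, and its slope terms
  cancel in the weighted average. This suits functions glued from pieces with known slopes.\<close>

lemma convex_on_UNIV_supporting_lines:
  fixes f :: "real \<Rightarrow> real"
  assumes "\<And>z y. f z + m z * (y - z) \<le> f y"
  shows "convex_on UNIV f"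
proof (intro convex_onI)
  fix t x y :: real
  assume t: "0 < t" "t < 1"
  define w where "w = (1 - t) *\<^sub>R x + t *\<^sub>R y"
  have "f w = (1 - t) * (f w + m w * (x - w)) + t * (f w + m w * (y - w))"
    by (simp add: w_def algebra_simps)
  also have "\<dots> \<le> (1 - t) * f x + t * f y"
    using t assms by (intro add_mono mult_left_mono) auto
  finally show "f ((1 - t) *\<^sub>R x + t *\<^sub>R y) \<le> (1 - t) * f x + t * f y"
    by (simp add: w_def)
qed simp

text \<open>Outside an interval around 1 the function g is continued by its supporting lines at the
  endpoints. Subtracting the line at the right end, with slope \<beta> n and intercept \<kappa> n,
  leaves a nonnegative decreasing function that is 0 from there on. The upper bound g and the fixed
  lower line c + d x are what dominated convergence requires.\<close>

lemma convex_half_line_truncation: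
  fixes g :: "real \<Rightarrow> real"
  assumes g: "convex_on {0<..} g"
  obtains \<psi> :: "nat \<Rightarrow> real \<Rightarrow> real" and K \<beta> \<kappa> :: "nat \<Rightarrow> real" and c d :: real
  where "\<And>n. convex_on UNIV (\<psi> n)" "\<And>n x. 0 \<le> \<psi> n x" "\<And>n. antimono (\<psi> n)"
    "\<And>n x. K n \<le> x \<Longrightarrow> \<psi> n x = 0"
    "\<And>n x. 0 < x \<Longrightarrow> \<psi> n x + \<beta> n * x + \<kappa> n \<le> g x"
    "\<And>n x. c + d * x \<le> \<psi> n x + \<beta> n * x + \<kappa> n"
    "\<And>x. 0 < x \<Longrightarrow> \<forall>\<^sub>F n in sequentially. \<psi> n x + \<beta> n * x + \<kappa> n = g x"
proof -
  \<comment> \<open>The right derivative of g, serving as a monotone choice of subgradient.\<close>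
  define b where "b x = Inf ((\<lambda>t. (g x - g t) / (x - t)) ` ({x<..} \<inter> {0<..}))" for x
  have b: "g x + b x * (y - x) \<le> g y" if "0 < x" "0 < y" for x y
    unfolding b_def using that
    by (intro convex_le_Inf_differential[OF g]) (auto simp: interior_open)
  have b_mono: "b x \<le> b y" if "0 < x" "x \<le> y" for x y
  proof (cases "x = y")
    case False
    have "(b x - b y) * (y - x) \<le> 0"
      using b[of x y] b[of y x] that by (simp add: algebra_simps)
    then show ?thesis
      using False that by (simp add: mult_le_0_iff)
  qed simp
  \<comment> \<open>The successor gives r n \<ge> 1 also at n = 0, so the interval from 1 / r n to r
    n is nonempty and contains 1.\<close>
  define r where "r n = real (Suc n)" for n
  have r: "1 \<le> r n" "0 < 1 / r n" "1 / r n \<le> 1" "1 / r n \<le> r n" for n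
  proof -
    show "1 \<le> r n" by (simp add: r_def)
    then show "0 < 1 / r n" "1 / r n \<le> 1" by simp_all
    then show "1 / r n \<le> r n" using \<open>1 \<le> r n\<close> by linarith
  qed
  \<comment> \<open>The nearest point to x in that interval.\<close>
  define p where "p n x = max (1 / r n) (min x (r n))" for n x
  have p_pos: "0 < p n x" for n x
    unfolding p_def using r(2) max.cobounded1 by (rule order.strict_trans2)
  have p_le: "p n x \<le> r n" for n x
    using r(4)[of n] by (simp add: p_def)
  define G where "G n x = g (p n x) + b (p n x) * (x - p n x)" for n x
  have G_support: "G n z + b (p n z) * (y - z) \<le> G n y" for n z y
  proof -
    \<comment> \<open>Inside the interval both sides vanish. To the left of it y - p n y is negative
      and b is smallest at the left end; to the right it is positive and b is largest at the right
      end.\<close>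
    have "b (p n z) * (y - p n y) \<le> b (p n y) * (y - p n y)"
    proof -
      consider "y < p n y" "p n y = 1 / r n" | "y = p n y" | "p n y < y" "p n y = r n"
        using r(4)[of n] by (cases "y < 1 / r n"; cases "r n < y") (auto simp: p_def)
      then show ?thesis
      proof cases
        case 1
        have "1 / r n \<le> p n z"
          by (simp add: p_def)
        then have "b (p n y) \<le> b (p n z)"
          using 1 p_pos r(1)[of n] by (intro b_mono) auto
        then show ?thesis
          using 1 by (intro mult_right_mono_neg) auto
      next
        case 3
        have "b (p n z) \<le> b (p n y)"
          using 3 p_pos p_le by (intro b_mono) auto
        then show ?thesis
          using 3 by (intro mult_right_mono) auto
      qed simp
    qed
    moreover have "g (p n z) + b (p n z) * (p n y - p n z) \<le> g (p n y)"
      by (intro b p_pos)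
    ultimately show ?thesis
      by (simp add: G_def algebra_simps)
  qed
  define \<beta> where "\<beta> n = b (r n)" for n
  define \<kappa> where "\<kappa> n = g (r n) - b (r n) * r n" for n
  define \<psi> where "\<psi> n x = G n x - \<beta> n * x - \<kappa> n" for n x
  have G_eq: "\<psi> n x + \<beta> n * x + \<kappa> n = G n x" for n x
    by (simp add: \<psi>_def)
  have p_r: "p n (r n) = r n" for n
    using r(4)[of n] by (simp add: p_def)
  show thesis
  proof
    show "convex_on UNIV (\<psi> n)" for n
    proof (rule convex_on_UNIV_supporting_lines)
      fix z y
      show "\<psi> n z + (b (p n z) - \<beta> n) * (y - z) \<le> \<psi> n y"
        using G_support[of n z y] by (simp add: \<psi>_def algebra_simps)
    qed
    show "0 \<le> \<psi> n x" for n x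
      using G_support[of n "r n" x] by (simp add: \<psi>_def G_def p_r \<beta>_def \<kappa>_def algebra_simps)
    show "antimono (\<psi> n)" for n
    proof (rule antimonoI)
      fix x y :: real
      assume "x \<le> y"
      moreover have "b (p n y) \<le> \<beta> n"
        unfolding \<beta>_def by (intro b_mono p_pos p_le)
      ultimately have "\<beta> n * (x - y) \<le> b (p n y) * (x - y)"
        by (intro mult_right_mono_neg) auto
      then show "\<psi> n y \<le> \<psi> n x"
        using G_support[of n y x] by (simp add: \<psi>_def algebra_simps)
    qed
    show "\<psi> n x = 0" if "r n \<le> x" for n x
    proof -
      have "p n x = r n"
        using that r(4)[of n] by (simp add: p_def)
      then show ?thesis
        by (simp add: \<psi>_def G_def \<beta>_def \<kappa>_def algebra_simps)
    qed
    show "\<psi> n x + \<beta> n * x + \<kappa> n \<le> g x" if "0 < x" for n x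
      unfolding G_eq G_def using that by (intro b p_pos)
    \<comment> \<open>Since 1 is in every interval, the supporting line of g at 1 supports every
      truncation, so c and d do not depend on n.\<close>
    show "(g 1 - b 1) + b 1 * x \<le> \<psi> n x + \<beta> n * x + \<kappa> n" for n x
    proof -
      have "p n 1 = 1"
        using r[of n] by (simp add: p_def)
      then show ?thesis
        using G_support[of n 1 x] unfolding G_eq by (simp add: G_def algebra_simps)
    qed
    show "\<forall>\<^sub>F n in sequentially. \<psi> n x + \<beta> n * x + \<kappa> n = g x" if "0 < x" for x
    proof -
      obtain m :: nat where m: "max x (1 / x) \<le> real m"
        using real_arch_simple by blast
      show ?thesis
      proof (rule eventually_sequentiallyI[of m])
        fix n
        assume "m \<le> n"
        then have "max x (1 / x) \<le> r n"
          using m by (simp add: r_def)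
        then have "x \<le> r n" "1 / r n \<le> x"
          using that r(1)[of n] by (simp_all add: field_simps)
        then have "p n x = x"
          by (simp add: p_def)
        then show "\<psi> n x + \<beta> n * x + \<kappa> n = g x"
          unfolding G_eq by (simp add: G_def)
      qed
    qed
  qed
qed

section \<open>Absence of an atom at 0\<close>

text \<open>Convexity of g is assumed only on the open half-line, so 0 must be a null value of X. An
  atom at 0 would bound the Laplace transform away from 0, whereas its exponent grows without bound
  because \<mu> is nonzero.\<close>

lemma ggc_AE_pos:
  assumes M: "prob_space M" and X: "ggc M X \<mu>"
  shows "AE \<omega> in M. 0 < X \<omega>"
proof -
  interpret prob_space M by fact
  note [measurable] = ggcD(1)[OF X]
  note \<mu> = thorin_measureD[OF ggcD(3)[OF X]]
  let ?Z = "{\<omega> \<in> space M. X \<omega> = 0}"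
  have "prob ?Z = 0"
  proof (rule ccontr)
    assume "prob ?Z \<noteq> 0"
    then have pos: "0 < prob ?Z"
      by (simp add: zero_less_measure_iff)
    have le: "(\<integral>u. ln (1 + real n / u) \<partial>\<mu>) \<le> - ln (prob ?Z)" for n
    proof -
      have "prob ?Z = (\<integral>\<omega>. indicator ?Z \<omega> \<partial>M)"
        by simp
      also have "\<dots> \<le> (\<integral>\<omega>. exp (- real n * X \<omega>) \<partial>M)"
      proof (intro integral_mono)
        show "integrable M (\<lambda>\<omega>. exp (- real n * X \<omega>))"
          using ggcD(2)[OF X] by (intro integrable_const_bound[where B=1])
            (auto elim!: eventually_mono)
        show "integrable M (indicator ?Z :: 'a \<Rightarrow> real)"
          by (intro integrable_real_indicator) (auto simp: less_top[symmetric])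
      qed (auto simp: indicator_def)
      also have "\<dots> = exp (- (\<integral>u. ln (1 + real n / u) \<partial>\<mu>))"
        by (intro ggcD(5)[OF X]) simp
      finally have "ln (prob ?Z) \<le> - (\<integral>u. ln (1 + real n / u) \<partial>\<mu>)"
        using pos by (metis exp_gt_zero ln_exp ln_le_cancel_iff)
      then show ?thesis
        by simp
    qed
    have "(\<integral>\<^sup>+u. \<infinity> \<partial>\<mu>) = (\<integral>\<^sup>+u. liminf (\<lambda>n. ennreal (ln (1 + real n / u))) \<partial>\<mu>)"
    \<comment> \<open>The integrands tend to infinity at every u, so Fatou's lemma bounds infinity
      times the mass of \<mu> by the finite number \<open>- ln (prob ?Z)\<close>.\<close>
    proof (intro nn_integral_cong)
      fix u
      assume "u \<in> space \<mu>"
      then have u: "0 < u"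
        using \<mu>(2) by simp
      have "filterlim (\<lambda>n. 1 + (1 / u) * real n) at_top sequentially"
        using u by (intro filterlim_tendsto_add_at_top[OF tendsto_const]
            filterlim_tendsto_pos_mult_at_top[OF tendsto_const] filterlim_real_sequentially) simp
      then have "filterlim (\<lambda>n. ln (1 + real n / u)) at_top sequentially"
        by (intro filterlim_compose[OF ln_at_top]) simp
      then show "\<infinity> = liminf (\<lambda>n. ennreal (ln (1 + real n / u)))"
        by (intro lim_imp_Liminf[symmetric]) (auto simp: ennreal_tendsto_top_eq_at_top)
    qed
    also have "\<dots> \<le> liminf (\<lambda>n. \<integral>\<^sup>+u. ennreal (ln (1 + real n / u)) \<partial>\<mu>)"
      by (intro nn_integral_liminf measurable_half_line[OF \<mu>(1)]) measurable
    also have "\<dots> \<le> liminf (\<lambda>n::nat. ennreal (- ln (prob ?Z)))"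
    proof (intro Liminf_mono always_eventually allI)
      fix n
      have "(\<integral>\<^sup>+u. ennreal (ln (1 + real n / u)) \<partial>\<mu>) = ennreal (\<integral>u. ln (1 + real n / u) \<partial>\<mu>)"
        using \<mu>(2) by (intro nn_integral_eq_integral ggcD(4)[OF X] AE_I2) auto
      then show "(\<integral>\<^sup>+u. ennreal (ln (1 + real n / u)) \<partial>\<mu>) \<le> ennreal (- ln (prob ?Z))"
        using le by (simp add: ennreal_leI)
    qed
    also have "\<dots> = ennreal (- ln (prob ?Z))"
      by (intro lim_imp_Liminf) auto
    finally show False
      using \<mu>(3) by (simp add: top_unique ennreal_top_mult)
  qed
  then have "AE \<omega> in M. \<omega> \<notin> ?Z"
    by (intro AE_not_in null_setsI) (auto simp: emeasure_eq_measure)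
  with ggcD(2)[OF X] AE_space show ?thesis
    by eventually_elim auto
qed

text \<open>The decreasing case applies to each \<psi> n. The affine parts have equal expectations
  because both means are 1, and both sides pass to the limit by dominated convergence.\<close>

theorem gamma_convex_le_ggc:
  fixes g :: "real \<Rightarrow> real"
  assumes M: "prob_space M" and X: "ggc M X \<mu>" and mass: "thorin_mass \<mu> < \<infinity>"
    and mean: "(\<integral>\<omega>. X \<omega> \<partial>M) = 1"
  defines "D \<equiv> enn2real (thorin_mass \<mu>)"
  assumes N: "prob_space N" and U: "distributed N lborel U (\<lambda>x. ennreal (gamma_density D D x))"
    and g: "convex_on {0<..} g"
    and gU: "integrable N (\<lambda>\<omega>. g (U \<omega>))" and gX: "integrable M (\<lambda>\<omega>. g (X \<omega>))"
  shows "(\<integral>\<omega>. g (U \<omega>) \<partial>N) \<le> (\<integral>\<omega>. g (X \<omega>) \<partial>M)"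
proof -
  interpret M: prob_space M by fact
  interpret N: prob_space N by fact
  note [measurable] = ggcD(1)[OF X]
  have [measurable]: "U \<in> borel_measurable N"
    using distributed_measurable[OF U] by simp
  have D: "0 < D"
    using thorin_measureD(3)[OF ggcD(3)[OF X]] mass
    by (auto simp: D_def thorin_mass_def enn2real_positive_iff zero_less_iff_neq_zero)
  \<comment> \<open>The Bochner integral of a non-integrable function is 0, so a mean of 1 forces
    integrability.\<close>
  have intX: "integrable M X"
    using mean not_integrable_integral_eq by fastforce
  note U_mean = gamma_distributed_mean[OF D D U]
  have X_pos: "AE \<omega> in M. 0 < X \<omega>"
    using M X by (rule ggc_AE_pos)
  have "AE x in distr N lborel U. 0 < x"
    unfolding distributed_distr_eq_density[OF U] by (subst AE_density) (auto simp: gamma_density_def)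
  then have U_pos: "AE \<omega> in N. 0 < U \<omega>"
    by (intro AE_distrD[of U N lborel]) auto
  obtain \<psi> :: "nat \<Rightarrow> real \<Rightarrow> real" and K \<beta> \<kappa> :: "nat \<Rightarrow> real" and c d :: real
    where \<psi>: "\<And>n. convex_on UNIV (\<psi> n)" "\<And>n x. 0 \<le> \<psi> n x" "\<And>n. antimono (\<psi> n)"
    "\<And>n x. K n \<le> x \<Longrightarrow> \<psi> n x = 0"
    and upper: "\<And>n x. 0 < x \<Longrightarrow> \<psi> n x + \<beta> n * x + \<kappa> n \<le> g x"
    and lower: "\<And>n x. c + d * x \<le> \<psi> n x + \<beta> n * x + \<kappa> n"
    and ev: "\<And>x. 0 < x \<Longrightarrow> \<forall>\<^sub>F n in sequentially. \<psi> n x + \<beta> n * x + \<kappa> n = g x"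
  proof (rule convex_half_line_truncation[OF g], goal_cases)
    case (1 \<psi> K \<beta> \<kappa> c d)
    show ?case
      by (rule that[OF 1(2-8)])
  qed
  have [measurable]: "\<psi> n \<in> borel_measurable borel" for n
    using \<psi>(1) by (rule convex_on_UNIV_measurable)
  let ?G = "\<lambda>n x. \<psi> n x + \<beta> n * x + \<kappa> n"
  have approx: "(\<lambda>n. \<integral>\<omega>. ?G n (V \<omega>) \<partial>P) \<longlonglongrightarrow> (\<integral>\<omega>. g (V \<omega>) \<partial>P)"
    and int: "\<And>n. integrable P (\<lambda>\<omega>. ?G n (V \<omega>))"
    if P: "prob_space P" and V: "integrable P V" and gV: "integrable P (\<lambda>\<omega>. g (V \<omega>))"
      and pos: "AE \<omega> in P. 0 < V \<omega>" for P :: "'c measure" and V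
  proof -
    interpret P: prob_space P by fact
    note [measurable] = borel_measurable_integrable[OF V] borel_measurable_integrable[OF gV]
    have w: "integrable P (\<lambda>\<omega>. \<bar>g (V \<omega>)\<bar> + \<bar>c + d * V \<omega>\<bar>)"
      using V gV by auto
    \<comment> \<open>The truncations lie between the line c + d x and g, which gives a dominating
      function independent of n.\<close>
    have bound: "AE \<omega> in P. norm (?G n (V \<omega>)) \<le> \<bar>g (V \<omega>)\<bar> + \<bar>c + d * V \<omega>\<bar>" for n
      using pos
    proof eventually_elim
      case (elim \<omega>)
      show ?case
        using upper[OF elim, of n] lower[of "V \<omega>" n] by (auto simp: abs_le_iff)
    qed
    show "integrable P (\<lambda>\<omega>. ?G n (V \<omega>))" for n
    proof (rule Bochner_Integration.integrable_bound[OF w])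
      show "AE \<omega> in P. norm (?G n (V \<omega>)) \<le> norm (\<bar>g (V \<omega>)\<bar> + \<bar>c + d * V \<omega>\<bar>)"
        using bound by (rule eventually_mono) simp
    qed measurable
    show "(\<lambda>n. \<integral>\<omega>. ?G n (V \<omega>) \<partial>P) \<longlonglongrightarrow> (\<integral>\<omega>. g (V \<omega>) \<partial>P)"
    proof (rule integral_dominated_convergence[OF _ _ w _ bound])
      show "AE \<omega> in P. (\<lambda>n. ?G n (V \<omega>)) \<longlonglongrightarrow> g (V \<omega>)"
        using pos by eventually_elim (intro tendsto_eventually ev)
    qed measurable
  qed
  have le: "(\<integral>\<omega>. ?G n (U \<omega>) \<partial>N) \<le> (\<integral>\<omega>. ?G n (X \<omega>) \<partial>M)" for n
  proof -
    have "(\<integral>\<^sup>+\<omega>. ennreal (\<psi> n (U \<omega>)) \<partial>N) = (\<integral>\<^sup>+u. ennreal (\<psi> n (u / D)) \<partial>gamma_measure D)"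
      \<comment> \<open>U has rate D, so it is distributed as u / D with u of rate 1.\<close>
      using distributed_nn_integral[OF U, of "\<lambda>x. ennreal (\<psi> n x)"]
        nn_integral_gamma_density_scale[OF D, of "\<lambda>x. ennreal (\<psi> n x)" D]
      by (simp add: nn_integral_gamma_measure)
    then have "(\<integral>\<omega>. \<psi> n (U \<omega>) \<partial>N) = (\<integral>u. \<psi> n (u / D) \<partial>gamma_measure D)"
      using \<psi>(2) by (simp add: integral_eq_nn_integral)
    also have "\<dots> \<le> (\<integral>\<omega>. \<psi> n (X \<omega>) \<partial>M)"
      unfolding D_def by (intro gamma_le_ggc_of_decreasing[where K = "K n"] assms(1-4) intX \<psi>)
    finally have *: "(\<integral>\<omega>. \<psi> n (U \<omega>) \<partial>N) \<le> (\<integral>\<omega>. \<psi> n (X \<omega>) \<partial>M)" .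
    \<comment> \<open>For a variable of mean 1 the affine part always contributes \<beta> n +
      \<kappa> n. Integrability of \<psi> n follows by subtracting that part.\<close>
    have split: "(\<integral>\<omega>. ?G n (V \<omega>) \<partial>P) = (\<integral>\<omega>. \<psi> n (V \<omega>) \<partial>P) + \<beta> n + \<kappa> n"
      if P: "prob_space P" and V: "integrable P V" "(\<integral>\<omega>. V \<omega> \<partial>P) = 1"
        and GV: "integrable P (\<lambda>\<omega>. ?G n (V \<omega>))" for P :: "'c measure" and V
    proof -
      interpret P: prob_space P by fact
      have "integrable P (\<lambda>\<omega>. ?G n (V \<omega>) - (\<beta> n * V \<omega> + \<kappa> n))"
        using GV V by (intro Bochner_Integration.integrable_diff) auto
      then have "integrable P (\<lambda>\<omega>. \<psi> n (V \<omega>))"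
        by simp
      then show ?thesis
        using V by (simp add: P.prob_space)
    qed
    show ?thesis
      using * split[OF N U_mean(1) _ int[OF N U_mean(1) gU U_pos]]
        split[OF M intX mean int[OF M intX gX X_pos]] U_mean(2) D
      by simp
  qed
  show ?thesis
    using LIMSEQ_le[OF approx[OF N U_mean(1) gU U_pos] approx[OF M intX gX X_pos]] le by blast
qed

subsection \<open>Sums of independent generalized gamma convolutions\<close>

text \<open>Indicators are covered by \<open>emeasure_measure_sum\<close>; the rest is linearity and
  monotone convergence, where monotonicity allows the supremum to be exchanged with the finite
  sum.\<close>

lemma nn_integral_measure_sum:
  assumes I: "finite I" and \<mu>: "\<And>i. i \<in> I \<Longrightarrow> sets (\<mu> i) = sets (restrict_space borel {0<..})"
    and f: "f \<in> borel_measurable (restrict_space borel {0<..})"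
  shows "(\<integral>\<^sup>+u. f u \<partial>measure_sum I \<mu>) = (\<Sum>i\<in>I. \<integral>\<^sup>+u. f u \<partial>\<mu> i)"
proof -
  let ?R = "restrict_space borel {0::real<..}"
  have sets: "sets (measure_sum I \<mu>) = sets ?R"
    by (rule sets_measure_sum)
  have space: "space (measure_sum I \<mu>) = space ?R" "\<And>i. i \<in> I \<Longrightarrow> space (\<mu> i) = space ?R"
    using sets_eq_imp_space_eq[OF sets] sets_eq_imp_space_eq[OF \<mu>] by auto
  have meas: "v \<in> borel_measurable (measure_sum I \<mu>)" "\<And>i. i \<in> I \<Longrightarrow> v \<in> borel_measurable (\<mu> i)"
    if "v \<in> borel_measurable ?R" for v :: "real \<Rightarrow> ennreal"
    using that measurable_cong_sets[OF sets refl] measurable_cong_sets[OF \<mu> refl] by blast+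
  show ?thesis
    using f
  proof (induction rule: borel_measurable_induct)
    case (cong f g)
    have "(\<integral>\<^sup>+u. f u \<partial>measure_sum I \<mu>) = (\<integral>\<^sup>+u. g u \<partial>measure_sum I \<mu>)"
      using cong(3) space by (intro nn_integral_cong) auto
    moreover have "(\<Sum>i\<in>I. \<integral>\<^sup>+u. f u \<partial>\<mu> i) = (\<Sum>i\<in>I. \<integral>\<^sup>+u. g u \<partial>\<mu> i)"
      using cong(3) space by (intro sum.cong nn_integral_cong) auto
    ultimately show ?case
      using cong(4) by simp
  next
    case (set A)
    then show ?case
      using emeasure_measure_sum[OF I \<mu> set] by (simp add: sets_measure_sum \<mu>)
  next
    case (mult v c)
    then show ?case
      by (simp add: nn_integral_cmult meas sum_distrib_left)
  next
    case (add v w)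
    then show ?case
      by (simp add: nn_integral_add meas sum.distrib)
  next
    case (seq V)
    have "(\<integral>\<^sup>+u. (SUP n. V n) u \<partial>measure_sum I \<mu>) = (SUP n. \<integral>\<^sup>+u. V n u \<partial>measure_sum I \<mu>)"
      unfolding SUP_apply using seq by (intro nn_integral_monotone_convergence_SUP meas) auto
    also have "\<dots> = (SUP n. \<Sum>i\<in>I. \<integral>\<^sup>+u. V n u \<partial>\<mu> i)"
      using seq by simp
    also have "\<dots> = (\<Sum>i\<in>I. SUP n. \<integral>\<^sup>+u. V n u \<partial>\<mu> i)"
      using \<open>incseq V\<close>
      by (intro ennreal_SUP_sum) (auto simp: incseq_def le_fun_def intro!: nn_integral_mono)
    also have "\<dots> = (\<Sum>i\<in>I. \<integral>\<^sup>+u. (SUP n. V n) u \<partial>\<mu> i)"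
      unfolding SUP_apply using seq
      by (intro sum.cong nn_integral_monotone_convergence_SUP[symmetric] meas) auto
    finally show ?case .
  qed
qed

lemma thorin_mass_measure_sum:
  assumes "finite I" "\<And>i. i \<in> I \<Longrightarrow> thorin_measure (\<mu> i)"
  shows "thorin_mass (measure_sum I \<mu>) = (\<Sum>i\<in>I. thorin_mass (\<mu> i))"
  unfolding thorin_mass_def
  using assms by (intro nn_integral_measure_sum thorin_measureD) auto

lemma thorin_measure_measure_sum:
  assumes I: "finite I" "I \<noteq> {}" and \<mu>: "\<And>i. i \<in> I \<Longrightarrow> thorin_measure (\<mu> i)"
  shows "thorin_measure (measure_sum I \<mu>)"
proof -
  note sets = thorin_measureD(1)[OF \<mu>]
  have mass: "emeasure \<nu> (space \<nu>) = thorin_mass \<nu>" for \<nu>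
    by (simp add: thorin_mass_def)
  \<comment> \<open>One summand of positive mass makes the sum nonzero; this is where nonemptiness
    of I enters.\<close>
  obtain i where i: "i \<in> I"
    using I by auto
  have "0 < thorin_mass (\<mu> i)"
    using thorin_measureD(3)[OF \<mu>[OF i]] by (simp add: mass zero_less_iff_neq_zero)
  also have "\<dots> \<le> (\<Sum>i\<in>I. thorin_mass (\<mu> i))"
    using I(1) i by (intro member_le_sum) auto
  also have "\<dots> = thorin_mass (measure_sum I \<mu>)"
    by (intro thorin_mass_measure_sum[symmetric] I(1) \<mu>)
  finally have "thorin_mass (measure_sum I \<mu>) \<noteq> 0"
    by simp
  moreover have "(\<integral>\<^sup>+u\<in>{0<..1}. ennreal \<bar>ln u\<bar> \<partial>measure_sum I \<mu>)
    = (\<Sum>i\<in>I. \<integral>\<^sup>+u\<in>{0<..1}. ennreal \<bar>ln u\<bar> \<partial>\<mu> i)"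
    by (intro nn_integral_measure_sum I(1) sets measurable_restrict_space1) auto
  moreover have "(\<integral>\<^sup>+u\<in>{1<..}. ennreal (1 / u) \<partial>measure_sum I \<mu>)
    = (\<Sum>i\<in>I. \<integral>\<^sup>+u\<in>{1<..}. ennreal (1 / u) \<partial>\<mu> i)"
    by (intro nn_integral_measure_sum I(1) sets measurable_restrict_space1) auto
  moreover have "(\<integral>\<^sup>+u\<in>{0<..1}. ennreal \<bar>ln u\<bar> \<partial>\<mu> i) < \<infinity>"
    "(\<integral>\<^sup>+u\<in>{1<..}. ennreal (1 / u) \<partial>\<mu> i) < \<infinity>" if "i \<in> I" for i
    using \<mu>[OF that] by (auto simp: thorin_measure_def)
  ultimately show ?thesis
    unfolding thorin_measure_def mass by (simp add: sets_measure_sum I(1) less_top)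
qed

text \<open>Independence turns the Laplace transform of the sum into a product, so the exponents
  add; the integral of ln (1 + s / u) is additive in the measure as well.\<close>

lemma ggc_sum:
  assumes M: "prob_space M" and I: "finite I" "I \<noteq> {}"
    and indep: "prob_space.indep_vars M (\<lambda>_. borel) X I"
    and X: "\<And>i. i \<in> I \<Longrightarrow> ggc M (X i) (\<mu> i)"
  shows "ggc M (\<lambda>\<omega>. \<Sum>i\<in>I. X i \<omega>) (measure_sum I \<mu>)"
proof -
  interpret prob_space M by fact
  note \<mu> = thorin_measureD[OF ggcD(3)[OF X]]
  have thorin: "thorin_measure (measure_sum I \<mu>)"
    using I ggcD(3)[OF X] by (rule thorin_measure_measure_sum)
  have "integrable (measure_sum I \<mu>) (\<lambda>u. ln (1 + s / u)) \<and>
    (\<integral>\<omega>. exp (- s * (\<Sum>i\<in>I. X i \<omega>)) \<partial>M) = exp (- (\<integral>u. ln (1 + s / u) \<partial>measure_sum I \<mu>))"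
    if s: "0 \<le> s" for s
  proof
    have nonneg: "0 \<le> ln (1 + s / u)" if "0 < u" for u
      using that s by simp
    have fin: "(\<integral>\<^sup>+u. ennreal (ln (1 + s / u)) \<partial>\<mu> i) = ennreal (\<integral>u. ln (1 + s / u) \<partial>\<mu> i)"
      if "i \<in> I" for i
      using \<mu>(2)[OF that] nonneg by (intro nn_integral_eq_integral ggcD(4)[OF X[OF that]] s AE_I2) auto
    have i_nonneg: "0 \<le> (\<integral>u. ln (1 + s / u) \<partial>\<mu> i)" if "i \<in> I" for i
      using \<mu>(2)[OF that] nonneg by (intro integral_nonneg_AE AE_I2) auto
    have "(\<integral>\<^sup>+u. ennreal (ln (1 + s / u)) \<partial>measure_sum I \<mu>) = (\<Sum>i\<in>I. \<integral>\<^sup>+u. ennreal (ln (1 + s / u)) \<partial>\<mu> i)"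
      by (intro nn_integral_measure_sum I(1) \<mu>(1) measurable_restrict_space1) auto
    also have "\<dots> = ennreal (\<Sum>i\<in>I. \<integral>u. ln (1 + s / u) \<partial>\<mu> i)"
      using fin i_nonneg by simp
    \<comment> \<open>Additivity is obtained for nonnegative integrals. The finite value gives both
      the integrability and the real identity below.\<close>
    finally have nn: "(\<integral>\<^sup>+u. ennreal (ln (1 + s / u)) \<partial>measure_sum I \<mu>) = \<dots>" .
    have meas: "(\<lambda>u. ln (1 + s / u)) \<in> borel_measurable (measure_sum I \<mu>)"
      by (intro measurable_half_line[OF sets_measure_sum]) measurable
    have AE_nonneg: "AE u in measure_sum I \<mu>. 0 \<le> ln (1 + s / u)"
      using thorin_measureD(2)[OF thorin] nonneg by (intro AE_I2) auto
    show "integrable (measure_sum I \<mu>) (\<lambda>u. ln (1 + s / u))"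
      using meas AE_nonneg nn by (intro integrableI_nonneg) auto
    have "(\<integral>u. ln (1 + s / u) \<partial>measure_sum I \<mu>) = (\<Sum>i\<in>I. \<integral>u. ln (1 + s / u) \<partial>\<mu> i)"
      using meas AE_nonneg nn i_nonneg by (simp add: integral_eq_nn_integral sum_nonneg)
    then have "exp (- (\<integral>u. ln (1 + s / u) \<partial>measure_sum I \<mu>)) = (\<Prod>i\<in>I. exp (- (\<integral>u. ln (1 + s / u) \<partial>\<mu> i)))"
      by (simp add: sum_negf[symmetric] exp_sum[OF I(1)])
    also have "\<dots> = (\<Prod>i\<in>I. \<integral>\<omega>. exp (- s * X i \<omega>) \<partial>M)"
      using ggcD(5)[OF X s] by (intro prod.cong) auto
    also have "\<dots> = (\<integral>\<omega>. (\<Prod>i\<in>I. exp (- s * X i \<omega>)) \<partial>M)"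
    proof (rule indep_vars_lebesgue_integral[symmetric, OF I(1)])
      show "indep_vars (\<lambda>_. borel) (\<lambda>i \<omega>. exp (- s * X i \<omega>)) I"
        by (rule indep_vars_compose2[OF indep]) measurable
      show "integrable M (\<lambda>\<omega>. exp (- s * X i \<omega>))" if "i \<in> I" for i
        using ggcD(1,2)[OF X[OF that]] s
        by (intro integrable_const_bound[where B=1]) (auto elim!: eventually_mono)
    qed
    also have "\<dots> = (\<integral>\<omega>. exp (- s * (\<Sum>i\<in>I. X i \<omega>)) \<partial>M)"
      by (simp add: exp_sum[OF I(1), symmetric] sum_distrib_left sum_negf)
    finally show "(\<integral>\<omega>. exp (- s * (\<Sum>i\<in>I. X i \<omega>)) \<partial>M)
      = exp (- (\<integral>u. ln (1 + s / u) \<partial>measure_sum I \<mu>))" ..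
  qed
  moreover have "AE \<omega> in M. 0 \<le> (\<Sum>i\<in>I. X i \<omega>)"
  proof -
    have "AE \<omega> in M. \<forall>i\<in>I. 0 \<le> X i \<omega>"
      using ggcD(2)[OF X] I(1) by (subst AE_finite_all) auto
    then show ?thesis
      by (rule eventually_mono) (auto intro: sum_nonneg)
  qed
  moreover have "(\<lambda>\<omega>. \<Sum>i\<in>I. X i \<omega>) \<in> borel_measurable M"
    using ggcD(1)[OF X] by (rule borel_measurable_sum)
  ultimately show ?thesis
    using thorin unfolding ggc_def by blast
qed

section \<open>The maximum ratio combining system\<close>

theorem mainTheorem13:
  fixes M :: "'a measure" and X :: "nat \<Rightarrow> 'a \<Rightarrow> real"
    and \<mu> :: "nat \<Rightarrow> real measure" and L :: nat
  assumes "prob_space M"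
    and "L \<ge> 1"
    and "prob_space.indep_vars M (\<lambda>_. borel) X {1..L}"
    and "\<And>i. i \<in> {1..L} \<Longrightarrow> ggc M (X i) (\<mu> i)"
    and "\<And>i. i \<in> {1..L} \<Longrightarrow> thorin_mass (\<mu> i) < \<infinity>"
  shows "ggc M (mrc_power L X) (measure_sum {1..L} \<mu>) \<and>
    thorin_mass (measure_sum {1..L} \<mu>) = (\<Sum>i=1..L. thorin_mass (\<mu> i)) \<and>
    (\<Sum>i=1..L. thorin_mass (\<mu> i)) < \<infinity> \<and>
    (let D = enn2real (\<Sum>i=1..L. thorin_mass (\<mu> i)) in
      prob_space.expectation M (mrc_power L X) = 1 \<longrightarrow>
      (\<forall>(N :: 'b measure) (U :: 'b \<Rightarrow> real) (g :: real \<Rightarrow> real).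
        prob_space N \<longrightarrow>
        distributed N lborel U (\<lambda>x. ennreal (gamma_density D D x)) \<longrightarrow>
        convex_on {0<..} g \<longrightarrow>
        integrable N (\<lambda>\<omega>. g (U \<omega>)) \<longrightarrow>
        integrable M (\<lambda>\<omega>. g (mrc_power L X \<omega>)) \<longrightarrow>
        prob_space.expectation N (\<lambda>\<omega>. g (U \<omega>))
          \<le> prob_space.expectation M (\<lambda>\<omega>. g (mrc_power L X \<omega>))))"
proof -
  \<comment> \<open>L \<ge> 1 makes the set of branches nonempty, as a nonzero Thorin measure
    requires.\<close>
  have ggc: "ggc M (mrc_power L X) (measure_sum {1..L} \<mu>)"
    unfolding mrc_power_def[abs_def] using assms(2) by (intro ggc_sum assms(1,3,4)) auto
  have mass: "thorin_mass (measure_sum {1..L} \<mu>) = (\<Sum>i=1..L. thorin_mass (\<mu> i))"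
    by (intro thorin_mass_measure_sum ggcD(3)[OF assms(4)]) auto
  have finite: "(\<Sum>i=1..L. thorin_mass (\<mu> i)) < \<infinity>"
    using assms(5) by (simp add: less_top)
  show ?thesis
    \<comment> \<open>By \<open>mass\<close> the shape D in \<open>gamma_convex_le_ggc\<close> is
      the real value of the sum of the branch masses.\<close>
    unfolding Let_def
    using ggc mass finite gamma_convex_le_ggc[OF assms(1) ggc] by auto
qed

end
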